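(* Let $(\mathcal{C},\mathbb{E},\mathfrak{s})$ be an extriangulated category satisfying Condition (WIC). Let $(\mathcal{Q},\widetilde{\mathcal{R}})$ and $(\widetilde{\mathcal{Q}},\mathcal{R})$ be two hereditary cotorsion pairs in $\mathcal{C}$ such that $\widetilde{\mathcal{R}}\subseteq\mathcal{R}$, $\widetilde{\mathcal{Q}}\subseteq\mathcal{Q}$ and $\widetilde{\mathcal{Q}}\cap\mathcal{R}=\mathcal{Q}\cap\widetilde{\mathcal{R}}$. Then there exists a unique thick class $\mathcal{W}$ of objects of $\mathcal{C}$ for which $(\mathcal{Q},\mathcal{W},\mathcal{R})$ is a Hovey triple. Moreover, this thick class $\mathcal{W}$ can be described in the two following ways: $$\mathcal{W}=\{X\in\mathcal{C}\mid \text{there exists an } \mathbb{E}\text{-triangle } X\to R\to Q\dashrightarrow \text{ with } R\in\widetilde{\mathcal{R}},\ Q\in\widetilde{\mathcal{Q}}\}$$ $$\phantom{\mathcal{W}}=\{X\in\mathcal{C}\mid \text{there exists an } \mathbb{E}\text{-triangle } R'\to Q'\to X\dashrightarrow \text{ with } R'\in\widetilde{\mathcal{R}},\ Q'\in\widetilde{\mathcal{Q}}\}.$$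
   Context: **Extensions.** Let $\mathcal{C}$ be an additive category and $\mathbb{E}:\mathcal{C}^{\mathrm{op}}\times\mathcal{C}\to \mathrm{Ab}$ an additive bifunctor. An element $\delta\in\mathbb{E}(C,A)$ is called an $\mathbb{E}$-extension. For $a\in\mathcal{C}(A,A')$ and $c\in\mathcal{C}(C',C)$ write $a_*\delta=\mathbb{E}(C,a)(\delta)\in\mathbb{E}(C,A')$ and $c^*\delta=\mathbb{E}(c,A)(\delta)\in\mathbb{E}(C',A)$. The element $0\in\mathbb{E}(C,A)$ is the split extension. For $\delta\in\mathbb{E}(C,A)$, $\delta'\in\mathbb{E}(C',A')$, a morphism $(a,c):\delta\to\delta'$ is a pair $a\in\mathcal{C}(A,A')$, $c\in\mathcal{C}(C,C')$ with $a_*\delta=c^*\delta'$. $\delta\oplus\delta'\in\mathbb{E}(C\oplus C',A\oplus A')$ denotes the element corresponding to $(\delta,0,0,\delta')$ under $\mathbb{E}(C\oplus C',A\oplus A')\cong\mathbb{E}(C,A)\oplus\mathbb{E}(C,A')\oplus\mathbb{E}(C',A)\oplus\mathbb{E}(C',A')$. **Realization.** Two sequences $A\xrightarrow{x}B\xrightarrow{y}C$ and $A\xrightarrow{x'}B'\xrightarrow{y'}C$ are equivalent if there is an isomorphism $b:B\to B'$ with $bx=x'$, $y'b=y$; $[A\xrightarrow{x}B\xrightarrow{y}C]$ denotes the equivalence class. A realization $\mathfrak{s}$ assigns to each $\delta\in\mathbb{E}(C,A)$ an equivalence class $\mathfrak{s}(\delta)=[A\xrightarrow{x}B\xrightarrow{y}C]$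 (we say the sequence realizes $\delta$), such that whenever $\mathfrak{s}(\delta)=[A\xrightarrow{x}B\xrightarrow{y}C]$, $\mathfrak{s}(\delta')=[A'\xrightarrow{x'}B'\xrightarrow{y'}C']$ and $(a,c):\delta\to\delta'$ is a morphism, there is $b:B\to B'$ with $bx=x'a$, $y'b=cy$. It is additive if $\mathfrak{s}(0)=[A\to A\oplus C\to C]$ (canonical inclusion and projection) for $0\in\mathbb{E}(C,A)$, and $\mathfrak{s}(\delta\oplus\delta')=\mathfrak{s}(\delta)\oplus\mathfrak{s}(\delta')$ (termwise direct sum). **Extriangulated category.** $(\mathcal{C},\mathbb{E},\mathfrak{s})$ is extriangulated if: (ET1) $\mathbb{E}$ is a biadditive functor. (ET2) $\mathfrak{s}$ is an additive realization of $\mathbb{E}$. (ET3) If $A\xrightarrow{x}B\xrightarrow{y}C$ realizes $\delta$, $A'\xrightarrow{x'}B'\xrightarrow{y'}C'$ realizes $\delta'$, and $a:A\to A'$, $b:B\to B'$ satisfy $bx=x'a$, then there is $c:C\to C'$ with $cy=y'b$ and $a_*\delta=c^*\delta'$. (ET3)$^{\mathrm{op}}$ Dually, if $b:B\to B'$, $c:C\to C'$ satisfy $cy=y'b$, there is $a:A\to A'$ with $bx=x'a$ and $a_*\delta=c^*\delta'$. (ET4) If $A\xrightarrow{f}B\xrightarrow{f'}D$ realizes $\delta\in\mathbb{E}(D,A)$ and $B\xrightarrow{g}C\xrightarrow{g'}F$ realizes $\delta'\in\mathbb{E}(F,B)$, then there exist an object $E$, morphisms $d:D\to E$, $e:E\to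 F$, $h=gf:A\to C$, $h':C\to E$ with $h'g=df'$, $eh'=g'$, and $\delta''\in\mathbb{E}(E,A)$ realized by $A\xrightarrow{h}C\xrightarrow{h'}E$, such that $D\xrightarrow{d}E\xrightarrow{e}F$ realizes $f'_*\delta'$, $d^*\delta''=\delta$ and $f_*\delta''=e^*\delta'$. (ET4)$^{\mathrm{op}}$ Dually, if $D\xrightarrow{f'}A\xrightarrow{f}B$ realizes $\delta\in\mathbb{E}(B,D)$ and $F\xrightarrow{g'}B\xrightarrow{g}C$ realizes $\delta'\in\mathbb{E}(C,F)$, then there exist an object $E$, morphisms $d:D\to E$, $e:E\to F$, $h':E\to A$, $h=gf:A\to C$ with $h'd=f'$, $fh'=g'e$, and $\delta''\in\mathbb{E}(C,E)$ realized by $E\xrightarrow{h'}A\xrightarrow{h}C$, such that $D\xrightarrow{d}E\xrightarrow{e}F$ realizes $g'^*\delta$, $e_*\delta''=\delta'$ and $d_*\delta=g^*\delta''$. **Terminology.** A sequence $A\xrightarrow{x}B\xrightarrow{y}C$ realizing some $\delta\in\mathbb{E}(C,A)$ is a conflation; then $x$ is an inflation and $y$ a deflation, and the pair (sequence, $\delta$) is an $\mathbb{E}$-triangle, written $A\xrightarrow{x}B\xrightarrow{y}C\overset{\delta}{\dashrightarrow}$ (with $\delta$ often omitted). **Condition (WIC).** For all composable $f\in\mathcal{C}(A,B)$, $g\in\mathcal{C}(B,C)$: (1) if $gf$ is an inflation, then so is $f$; (2) if $gf$ is a deflation, then so is $g$. **Cotorsion pairs.** Let $\mathcal{Q},\mathcal{R}$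 be classes of objects (full additive subcategories) of $\mathcal{C}$, closed under isomorphisms, finite direct sums and direct summands. $(\mathcal{Q},\mathcal{R})$ is a cotorsion pair if (a) $\mathbb{E}(Q,R)=0$ for all $Q\in\mathcal{Q}$, $R\in\mathcal{R}$; and (b) for every $C\in\mathcal{C}$ there are $\mathbb{E}$-triangles $R_C\to Q_C\to C\dashrightarrow$ and $C\to R^C\to Q^C\dashrightarrow$ with $Q_C,Q^C\in\mathcal{Q}$ and $R_C,R^C\in\mathcal{R}$. It is hereditary if $\mathcal{Q}$ is closed under cocones of deflations (for any $\mathbb{E}$-triangle $A\to B\to C\dashrightarrow$ with $B,C\in\mathcal{Q}$, also $A\in\mathcal{Q}$) and $\mathcal{R}$ is closed under cones of inflations (for any $\mathbb{E}$-triangle $A\to B\to C\dashrightarrow$ with $A,B\in\mathcal{R}$, also $C\in\mathcal{R}$). **Thick classes and Hovey triples.** A class $\mathcal{W}$ of objects is thick if it is closed under direct summands and, for any $\mathbb{E}$-triangle $A\to B\to C\dashrightarrow$ with two of the three terms in $\mathcal{W}$, the third term is in $\mathcal{W}$. A triple $(\mathcal{Q},\mathcal{W},\mathcal{R})$ of classes of objects is a Hovey triple if $(\mathcal{Q},\mathcal{W}\cap\mathcal{R})$ and $(\mathcal{Q}\cap\mathcal{W},\mathcal{R})$ are cotorsion pairs and $\mathcal{W}$ is thick. *)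

theory Defs
  imports "HOL-Algebra.Group"
begin

text \<open>
  Abelian groups are HOL-Algebra's \<^locale>\<open>comm_group\<close>s. These are written multiplicatively, so in
  the groups of morphisms and of extensions below \<open>\<otimes>\<close> is addition and \<open>\<one>\<close> is zero.
\<close>


section \<open>Additive categories\<close>

text \<open>
  The objects of a category are the elements of the type \<open>'o\<close>. The groups of morphisms all live in
  one type \<open>'m\<close> and are pairwise disjoint (an axiom of \<open>additive_category\<close>), so that a morphism
  determines its source and target. The composite \<open>gf\<close> is written \<open>g \<cdot> f\<close>.
\<close>

record ('o, 'm) cat =
  Hom :: "'o \<Rightarrow> 'o \<Rightarrow> 'm monoid" (\<open>Hom\<index>\<close>)
  Idn :: "'o \<Rightarrow> 'm" (\<open>Idn\<index>\<close>)
  cmp :: "'m \<Rightarrow> 'm \<Rightarrow> 'm" (infixl \<open>\<cdot>\<index>\<close> 75)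

abbreviation arr :: "('o, 'm, 'z) cat_scheme \<Rightarrow> 'm \<Rightarrow> 'o \<Rightarrow> 'o \<Rightarrow> bool"
    (\<open>\<guillemotleft>_ : _ \<rightarrow> _\<guillemotright>\<index>\<close>) where
  "\<guillemotleft>f : A \<rightarrow> B\<guillemotright>\<^bsub>\<C>\<^esub> \<equiv> f \<in> carrier (Hom\<^bsub>\<C>\<^esub> A B)"

definition is_iso :: "('o, 'm, 'z) cat_scheme \<Rightarrow> 'o \<Rightarrow> 'o \<Rightarrow> 'm \<Rightarrow> bool" where
  "is_iso \<C> A B f \<longleftrightarrow> \<guillemotleft>f : A \<rightarrow> B\<guillemotright> \<and> (\<exists>g. \<guillemotleft>g : B \<rightarrow> A\<guillemotright> \<and> g \<cdot> f = Idn A \<and> f \<cdot> g = Idn B)"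
  for \<C> (structure)

definition zero_object :: "('o, 'm, 'z) cat_scheme \<Rightarrow> 'o \<Rightarrow> bool" where
  "zero_object \<C> N \<longleftrightarrow> (\<forall>A. (\<exists>!f. \<guillemotleft>f : N \<rightarrow> A\<guillemotright>) \<and> (\<exists>!f. \<guillemotleft>f : A \<rightarrow> N\<guillemotright>))"
  for \<C> (structure)

text \<open>
  \<open>biproduct \<C> A B S i j p q\<close>: the object \<open>S\<close> is a direct sum of \<open>A\<close> and \<open>B\<close> with inclusions
  \<open>i\<close>, \<open>j\<close> and projections \<open>p\<close>, \<open>q\<close>. No choice of direct sums is fixed; every notion below that
  involves a direct sum refers to all of them.
\<close>

definition biproduct ::
    "('o, 'm, 'z) cat_scheme \<Rightarrow> 'o \<Rightarrow> 'o \<Rightarrow> 'o \<Rightarrow> 'm \<Rightarrow> 'm \<Rightarrow> 'm \<Rightarrow> 'm \<Rightarrow> bool" where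
  "biproduct \<C> A B S i j p q \<longleftrightarrow>
     \<guillemotleft>i : A \<rightarrow> S\<guillemotright> \<and> \<guillemotleft>j : B \<rightarrow> S\<guillemotright> \<and> \<guillemotleft>p : S \<rightarrow> A\<guillemotright> \<and> \<guillemotleft>q : S \<rightarrow> B\<guillemotright> \<and>
     p \<cdot> i = Idn A \<and> q \<cdot> j = Idn B \<and>
     q \<cdot> i = \<one>\<^bsub>Hom A B\<^esub> \<and> p \<cdot> j = \<one>\<^bsub>Hom B A\<^esub> \<and>
     (i \<cdot> p) \<otimes>\<^bsub>Hom S S\<^esub> (j \<cdot> q) = Idn S"
  for \<C> (structure)

locale additive_category =
  fixes \<C> :: "('o, 'm, 'z) cat_scheme" (structure)
  assumes hom_disjoint: "\<guillemotleft>f : A \<rightarrow> B\<guillemotright> \<Longrightarrow> \<guillemotleft>f : A' \<rightarrow> B'\<guillemotright> \<Longrightarrow> A = A' \<and> B = B'"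
    and Id_arr: "\<guillemotleft>Idn A : A \<rightarrow> A\<guillemotright>"
    and comp_arr: "\<guillemotleft>f : A \<rightarrow> B\<guillemotright> \<Longrightarrow> \<guillemotleft>g : B \<rightarrow> D\<guillemotright> \<Longrightarrow> \<guillemotleft>g \<cdot> f : A \<rightarrow> D\<guillemotright>"
    and comp_Id_left: "\<guillemotleft>f : A \<rightarrow> B\<guillemotright> \<Longrightarrow> Idn B \<cdot> f = f"
    and comp_Id_right: "\<guillemotleft>f : A \<rightarrow> B\<guillemotright> \<Longrightarrow> f \<cdot> Idn A = f"
    and comp_assoc: "\<guillemotleft>f : A \<rightarrow> B\<guillemotright> \<Longrightarrow> \<guillemotleft>g : B \<rightarrow> D\<guillemotright> \<Longrightarrow> \<guillemotleft>h : D \<rightarrow> F\<guillemotright> \<Longrightarrow>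
          (h \<cdot> g) \<cdot> f = h \<cdot> (g \<cdot> f)"
    and hom_group: "comm_group (Hom A B)"
    and comp_add_left: "\<guillemotleft>f : A \<rightarrow> B\<guillemotright> \<Longrightarrow> \<guillemotleft>g : B \<rightarrow> D\<guillemotright> \<Longrightarrow> \<guillemotleft>g' : B \<rightarrow> D\<guillemotright> \<Longrightarrow>
          (g \<otimes>\<^bsub>Hom B D\<^esub> g') \<cdot> f = (g \<cdot> f) \<otimes>\<^bsub>Hom A D\<^esub> (g' \<cdot> f)"
    and comp_add_right: "\<guillemotleft>f : A \<rightarrow> B\<guillemotright> \<Longrightarrow> \<guillemotleft>f' : A \<rightarrow> B\<guillemotright> \<Longrightarrow> \<guillemotleft>g : B \<rightarrow> D\<guillemotright> \<Longrightarrow>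
          g \<cdot> (f \<otimes>\<^bsub>Hom A B\<^esub> f') = (g \<cdot> f) \<otimes>\<^bsub>Hom A D\<^esub> (g \<cdot> f')"
    and zero_object_exists: "\<exists>N. zero_object \<C> N"
    and biproduct_exists: "\<exists>S i j p q. biproduct \<C> A B S i j p q"


section \<open>Extensions and realizations\<close>

text \<open>
  \<open>Ext C A\<close> is the group \<open>\<bbbE>(C, A)\<close>, contravariant in \<open>C\<close>; \<open>Emap c a\<close> is
  \<open>\<bbbE>(c, a) : \<bbbE>(C, A) \<rightarrow> \<bbbE>(C', A')\<close> for \<open>c : C' \<rightarrow> C\<close> and \<open>a : A \<rightarrow> A'\<close>. For \<open>\<delta> \<in> \<bbbE>(C, A)\<close>,
  \<open>rlz C A \<delta>\<close> is the equivalence class \<open>\<s>(\<delta>)\<close>, where a sequence \<open>A \<rightarrow> B \<rightarrow> C\<close> is encoded by its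
  pair of morphisms.
\<close>

record ('o, 'm, 'e) extcat = "('o, 'm) cat" +
  Ext :: "'o \<Rightarrow> 'o \<Rightarrow> 'e monoid" (\<open>Ext\<index>\<close>)
  Emap :: "'m \<Rightarrow> 'm \<Rightarrow> 'e \<Rightarrow> 'e" (\<open>Emap\<index>\<close>)
  rlz :: "'o \<Rightarrow> 'o \<Rightarrow> 'e \<Rightarrow> ('m \<times> 'm) set" (\<open>rlz\<index>\<close>)

text \<open>\<open>push \<C> C a \<delta>\<close> is \<open>a\<^sub>*\<delta> = \<bbbE>(C, a)(\<delta>)\<close> and \<open>pull \<C> A c \<delta>\<close> is \<open>c\<^sup>*\<delta> = \<bbbE>(c, A)(\<delta>)\<close>.\<close>

definition push :: "('o, 'm, 'e, 'z) extcat_scheme \<Rightarrow> 'o \<Rightarrow> 'm \<Rightarrow> 'e \<Rightarrow> 'e" where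
  "push \<C> C a \<delta> = Emap (Idn C) a \<delta>"
  for \<C> (structure)

definition pull :: "('o, 'm, 'e, 'z) extcat_scheme \<Rightarrow> 'o \<Rightarrow> 'm \<Rightarrow> 'e \<Rightarrow> 'e" where
  "pull \<C> A c \<delta> = Emap c (Idn A) \<delta>"
  for \<C> (structure)

definition biadditive_functor :: "('o, 'm, 'e, 'z) extcat_scheme \<Rightarrow> bool" where
  "biadditive_functor \<C> \<longleftrightarrow>
     (\<forall>C A. comm_group (Ext C A)) \<and>
     (\<forall>C C' A A' c a. \<guillemotleft>c : C' \<rightarrow> C\<guillemotright> \<longrightarrow> \<guillemotleft>a : A \<rightarrow> A'\<guillemotright> \<longrightarrow> Emap c a \<in> hom (Ext C A) (Ext C' A')) \<and>
     (\<forall>C A. \<forall>\<delta> \<in> carrier (Ext C A). Emap (Idn C) (Idn A) \<delta> = \<delta>) \<and>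
     (\<forall>C C' C'' A A' A'' c c' a a'. \<forall>\<delta> \<in> carrier (Ext C A).
        \<guillemotleft>c : C' \<rightarrow> C\<guillemotright> \<longrightarrow> \<guillemotleft>c' : C'' \<rightarrow> C'\<guillemotright> \<longrightarrow> \<guillemotleft>a : A \<rightarrow> A'\<guillemotright> \<longrightarrow> \<guillemotleft>a' : A' \<rightarrow> A''\<guillemotright> \<longrightarrow>
        Emap (c \<cdot> c') (a' \<cdot> a) \<delta> = Emap c' a' (Emap c a \<delta>)) \<and>
     (\<forall>C C' A A' c c' a. \<forall>\<delta> \<in> carrier (Ext C A).
        \<guillemotleft>c : C' \<rightarrow> C\<guillemotright> \<longrightarrow> \<guillemotleft>c' : C' \<rightarrow> C\<guillemotright> \<longrightarrow> \<guillemotleft>a : A \<rightarrow> A'\<guillemotright> \<longrightarrow>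
        Emap (c \<otimes>\<^bsub>Hom C' C\<^esub> c') a \<delta> = Emap c a \<delta> \<otimes>\<^bsub>Ext C' A'\<^esub> Emap c' a \<delta>) \<and>
     (\<forall>C C' A A' c a a'. \<forall>\<delta> \<in> carrier (Ext C A).
        \<guillemotleft>c : C' \<rightarrow> C\<guillemotright> \<longrightarrow> \<guillemotleft>a : A \<rightarrow> A'\<guillemotright> \<longrightarrow> \<guillemotleft>a' : A \<rightarrow> A'\<guillemotright> \<longrightarrow>
        Emap c (a \<otimes>\<^bsub>Hom A A'\<^esub> a') \<delta> = Emap c a \<delta> \<otimes>\<^bsub>Ext C' A'\<^esub> Emap c a' \<delta>)"
  for \<C> (structure)

definition seq_class :: "('o, 'm, 'z) cat_scheme \<Rightarrow> 'o \<Rightarrow> 'o \<Rightarrow> 'o \<Rightarrow> 'm \<Rightarrow> 'm \<Rightarrow> ('m \<times> 'm) set" where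
  "seq_class \<C> A B C x y =
     {(x', y'). \<exists>B' b. \<guillemotleft>x' : A \<rightarrow> B'\<guillemotright> \<and> \<guillemotleft>y' : B' \<rightarrow> C\<guillemotright> \<and> is_iso \<C> B B' b \<and> b \<cdot> x = x' \<and> y' \<cdot> b = y}"
  for \<C> (structure)

text \<open>
  \<open>etriangle \<C> A B C x y \<delta>\<close>: the sequence \<open>A \<rightarrow> B \<rightarrow> C\<close> given by \<open>x\<close> and \<open>y\<close> realizes
  \<open>\<delta> \<in> \<bbbE>(C, A)\<close>, that is, together with \<open>\<delta>\<close> it is an \<open>\<bbbE>\<close>-triangle.
\<close>

definition etriangle ::
    "('o, 'm, 'e, 'z) extcat_scheme \<Rightarrow> 'o \<Rightarrow> 'o \<Rightarrow> 'o \<Rightarrow> 'm \<Rightarrow> 'm \<Rightarrow> 'e \<Rightarrow> bool" where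
  "etriangle \<C> A B C x y \<delta> \<longleftrightarrow>
     \<delta> \<in> carrier (Ext C A) \<and> \<guillemotleft>x : A \<rightarrow> B\<guillemotright> \<and> \<guillemotleft>y : B \<rightarrow> C\<guillemotright> \<and> rlz C A \<delta> = seq_class \<C> A B C x y"
  for \<C> (structure)

definition realization :: "('o, 'm, 'e, 'z) extcat_scheme \<Rightarrow> bool" where
  "realization \<C> \<longleftrightarrow>
     (\<forall>C A. \<forall>\<delta> \<in> carrier (Ext C A). \<exists>B x y. etriangle \<C> A B C x y \<delta>) \<and>
     (\<forall>A B C x y \<delta> A' B' C' x' y' \<delta>' a c.
        etriangle \<C> A B C x y \<delta> \<longrightarrow> etriangle \<C> A' B' C' x' y' \<delta>' \<longrightarrow>
        \<guillemotleft>a : A \<rightarrow> A'\<guillemotright> \<longrightarrow> \<guillemotleft>c : C \<rightarrow> C'\<guillemotright> \<longrightarrow> push \<C> C a \<delta> = pull \<C> A' c \<delta>' \<longrightarrow>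
        (\<exists>b. \<guillemotleft>b : B \<rightarrow> B'\<guillemotright> \<and> b \<cdot> x = x' \<cdot> a \<and> y' \<cdot> b = c \<cdot> y))"
  for \<C> (structure)

text \<open>
  In the second clause, \<open>\<epsilon>\<close> is \<open>\<delta> \<oplus> \<delta>'\<close>, given by its four components, and the sequence on the right
  is \<open>A \<oplus> A' \<rightarrow> B \<oplus> B' \<rightarrow> C \<oplus> C'\<close> with morphisms \<open>x \<oplus> x'\<close> and \<open>y \<oplus> y'\<close>.
\<close>

definition additive_realization :: "('o, 'm, 'e, 'z) extcat_scheme \<Rightarrow> bool" where
  "additive_realization \<C> \<longleftrightarrow>
     realization \<C> \<and>
     (\<forall>A C S i j p q. biproduct \<C> A C S i j p q \<longrightarrow>
        rlz C A \<one>\<^bsub>Ext C A\<^esub> = seq_class \<C> A S C i q) \<and>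
     (\<forall>A B C x y \<delta> A' B' C' x' y' \<delta>' S\<^sub>A i\<^sub>A j\<^sub>A p\<^sub>A q\<^sub>A S\<^sub>B i\<^sub>B j\<^sub>B p\<^sub>B q\<^sub>B S\<^sub>C i\<^sub>C j\<^sub>C p\<^sub>C q\<^sub>C.
        etriangle \<C> A B C x y \<delta> \<longrightarrow> etriangle \<C> A' B' C' x' y' \<delta>' \<longrightarrow>
        biproduct \<C> A A' S\<^sub>A i\<^sub>A j\<^sub>A p\<^sub>A q\<^sub>A \<longrightarrow>
        biproduct \<C> B B' S\<^sub>B i\<^sub>B j\<^sub>B p\<^sub>B q\<^sub>B \<longrightarrow>
        biproduct \<C> C C' S\<^sub>C i\<^sub>C j\<^sub>C p\<^sub>C q\<^sub>C \<longrightarrow>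
        (\<forall>\<epsilon> \<in> carrier (Ext S\<^sub>C S\<^sub>A).
           Emap i\<^sub>C p\<^sub>A \<epsilon> = \<delta> \<longrightarrow> Emap i\<^sub>C q\<^sub>A \<epsilon> = \<one>\<^bsub>Ext C A'\<^esub> \<longrightarrow>
           Emap j\<^sub>C p\<^sub>A \<epsilon> = \<one>\<^bsub>Ext C' A\<^esub> \<longrightarrow> Emap j\<^sub>C q\<^sub>A \<epsilon> = \<delta>' \<longrightarrow>
           rlz S\<^sub>C S\<^sub>A \<epsilon> = seq_class \<C> S\<^sub>A S\<^sub>B S\<^sub>C
             ((i\<^sub>B \<cdot> x \<cdot> p\<^sub>A) \<otimes>\<^bsub>Hom S\<^sub>A S\<^sub>B\<^esub> (j\<^sub>B \<cdot> x' \<cdot> q\<^sub>A))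
             ((i\<^sub>C \<cdot> y \<cdot> p\<^sub>B) \<otimes>\<^bsub>Hom S\<^sub>B S\<^sub>C\<^esub> (j\<^sub>C \<cdot> y' \<cdot> q\<^sub>B))))"
  for \<C> (structure)


section \<open>Extriangulated categories\<close>

locale extriangulated_category = additive_category \<C>
  for \<C> :: "('o, 'm, 'e, 'z) extcat_scheme" (structure) +
  assumes ET1: "biadditive_functor \<C>"
    and ET2: "additive_realization \<C>"
    and ET3: "etriangle \<C> A B C x y \<delta> \<Longrightarrow> etriangle \<C> A' B' C' x' y' \<delta>' \<Longrightarrow>
          \<guillemotleft>a : A \<rightarrow> A'\<guillemotright> \<Longrightarrow> \<guillemotleft>b : B \<rightarrow> B'\<guillemotright> \<Longrightarrow> b \<cdot> x = x' \<cdot> a \<Longrightarrow>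
          \<exists>c. \<guillemotleft>c : C \<rightarrow> C'\<guillemotright> \<and> c \<cdot> y = y' \<cdot> b \<and> push \<C> C a \<delta> = pull \<C> A' c \<delta>'"
    and ET3op: "etriangle \<C> A B C x y \<delta> \<Longrightarrow> etriangle \<C> A' B' C' x' y' \<delta>' \<Longrightarrow>
          \<guillemotleft>b : B \<rightarrow> B'\<guillemotright> \<Longrightarrow> \<guillemotleft>c : C \<rightarrow> C'\<guillemotright> \<Longrightarrow> c \<cdot> y = y' \<cdot> b \<Longrightarrow>
          \<exists>a. \<guillemotleft>a : A \<rightarrow> A'\<guillemotright> \<and> b \<cdot> x = x' \<cdot> a \<and> push \<C> C a \<delta> = pull \<C> A' c \<delta>'"
    and ET4: "etriangle \<C> A B D f f' \<delta> \<Longrightarrow> etriangle \<C> B C F g g' \<delta>' \<Longrightarrow>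
          \<exists>E d e h h' \<delta>''.
            \<guillemotleft>d : D \<rightarrow> E\<guillemotright> \<and> \<guillemotleft>e : E \<rightarrow> F\<guillemotright> \<and> h = g \<cdot> f \<and> \<guillemotleft>h' : C \<rightarrow> E\<guillemotright> \<and>
            h' \<cdot> g = d \<cdot> f' \<and> e \<cdot> h' = g' \<and>
            etriangle \<C> A C E h h' \<delta>'' \<and>
            etriangle \<C> D E F d e (push \<C> F f' \<delta>') \<and>
            pull \<C> A d \<delta>'' = \<delta> \<and> push \<C> E f \<delta>'' = pull \<C> B e \<delta>'"
    and ET4op: "etriangle \<C> D A B f' f \<delta> \<Longrightarrow> etriangle \<C> F B C g' g \<delta>' \<Longrightarrow>
          \<exists>E d e h h' \<delta>''.
            \<guillemotleft>d : D \<rightarrow> E\<guillemotright> \<and> \<guillemotleft>e : E \<rightarrow> F\<guillemotright> \<and> \<guillemotleft>h' : E \<rightarrow> A\<guillemotright> \<and> h = g \<cdot> f \<and>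
            h' \<cdot> d = f' \<and> f \<cdot> h' = g' \<cdot> e \<and>
            etriangle \<C> E A C h' h \<delta>'' \<and>
            etriangle \<C> D E F d e (pull \<C> D g' \<delta>) \<and>
            push \<C> C e \<delta>'' = \<delta>' \<and> push \<C> B d \<delta> = pull \<C> E g \<delta>''"

definition inflation :: "('o, 'm, 'e, 'z) extcat_scheme \<Rightarrow> 'm \<Rightarrow> bool" where
  "inflation \<C> x \<longleftrightarrow> (\<exists>A B C y \<delta>. etriangle \<C> A B C x y \<delta>)"

definition deflation :: "('o, 'm, 'e, 'z) extcat_scheme \<Rightarrow> 'm \<Rightarrow> bool" where
  "deflation \<C> y \<longleftrightarrow> (\<exists>A B C x \<delta>. etriangle \<C> A B C x y \<delta>)"

definition WIC :: "('o, 'm, 'e, 'z) extcat_scheme \<Rightarrow> bool" where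
  "WIC \<C> \<longleftrightarrow>
     (\<forall>A B C f g. \<guillemotleft>f : A \<rightarrow> B\<guillemotright> \<longrightarrow> \<guillemotleft>g : B \<rightarrow> C\<guillemotright> \<longrightarrow>
        (inflation \<C> (g \<cdot> f) \<longrightarrow> inflation \<C> f) \<and>
        (deflation \<C> (g \<cdot> f) \<longrightarrow> deflation \<C> g))"
  for \<C> (structure)


section \<open>Cotorsion pairs and Hovey triples\<close>

definition closed_under_iso :: "('o, 'm, 'z) cat_scheme \<Rightarrow> 'o set \<Rightarrow> bool" where
  "closed_under_iso \<C> \<X> \<longleftrightarrow> (\<forall>A B f. is_iso \<C> A B f \<longrightarrow> A \<in> \<X> \<longrightarrow> B \<in> \<X>)"

text \<open>The empty direct sum is included: every zero object has to belong to the class.\<close>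

definition closed_under_direct_sums :: "('o, 'm, 'z) cat_scheme \<Rightarrow> 'o set \<Rightarrow> bool" where
  "closed_under_direct_sums \<C> \<X> \<longleftrightarrow>
     (\<forall>N. zero_object \<C> N \<longrightarrow> N \<in> \<X>) \<and>
     (\<forall>A B S i j p q. biproduct \<C> A B S i j p q \<longrightarrow> A \<in> \<X> \<longrightarrow> B \<in> \<X> \<longrightarrow> S \<in> \<X>)"

definition closed_under_summands :: "('o, 'm, 'z) cat_scheme \<Rightarrow> 'o set \<Rightarrow> bool" where
  "closed_under_summands \<C> \<X> \<longleftrightarrow>
     (\<forall>A B S i j p q. biproduct \<C> A B S i j p q \<longrightarrow> S \<in> \<X> \<longrightarrow> A \<in> \<X> \<and> B \<in> \<X>)"

definition cotorsion_pair :: "('o, 'm, 'e, 'z) extcat_scheme \<Rightarrow> 'o set \<Rightarrow> 'o set \<Rightarrow> bool" where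
  "cotorsion_pair \<C> \<Q> \<R> \<longleftrightarrow>
     closed_under_iso \<C> \<Q> \<and> closed_under_direct_sums \<C> \<Q> \<and> closed_under_summands \<C> \<Q> \<and>
     closed_under_iso \<C> \<R> \<and> closed_under_direct_sums \<C> \<R> \<and> closed_under_summands \<C> \<R> \<and>
     (\<forall>Q\<in>\<Q>. \<forall>R\<in>\<R>. carrier (Ext Q R) = {\<one>\<^bsub>Ext Q R\<^esub>}) \<and>
     (\<forall>C. (\<exists>R\<in>\<R>. \<exists>Q\<in>\<Q>. \<exists>x y \<delta>. etriangle \<C> R Q C x y \<delta>) \<and>
          (\<exists>R\<in>\<R>. \<exists>Q\<in>\<Q>. \<exists>x y \<delta>. etriangle \<C> C R Q x y \<delta>))"
  for \<C> (structure)

definition hereditary_cotorsion_pair ::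
    "('o, 'm, 'e, 'z) extcat_scheme \<Rightarrow> 'o set \<Rightarrow> 'o set \<Rightarrow> bool" where
  "hereditary_cotorsion_pair \<C> \<Q> \<R> \<longleftrightarrow>
     cotorsion_pair \<C> \<Q> \<R> \<and>
     (\<forall>A B C x y \<delta>. etriangle \<C> A B C x y \<delta> \<longrightarrow> B \<in> \<Q> \<longrightarrow> C \<in> \<Q> \<longrightarrow> A \<in> \<Q>) \<and>
     (\<forall>A B C x y \<delta>. etriangle \<C> A B C x y \<delta> \<longrightarrow> A \<in> \<R> \<longrightarrow> B \<in> \<R> \<longrightarrow> C \<in> \<R>)"

definition thick :: "('o, 'm, 'e, 'z) extcat_scheme \<Rightarrow> 'o set \<Rightarrow> bool" where
  "thick \<C> \<W> \<longleftrightarrow>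
     closed_under_summands \<C> \<W> \<and>
     (\<forall>A B C x y \<delta>. etriangle \<C> A B C x y \<delta> \<longrightarrow>
        (A \<in> \<W> \<longrightarrow> B \<in> \<W> \<longrightarrow> C \<in> \<W>) \<and>
        (A \<in> \<W> \<longrightarrow> C \<in> \<W> \<longrightarrow> B \<in> \<W>) \<and>
        (B \<in> \<W> \<longrightarrow> C \<in> \<W> \<longrightarrow> A \<in> \<W>))"

definition hovey_triple ::
    "('o, 'm, 'e, 'z) extcat_scheme \<Rightarrow> 'o set \<Rightarrow> 'o set \<Rightarrow> 'o set \<Rightarrow> bool" where
  "hovey_triple \<C> \<Q> \<W> \<R> \<longleftrightarrow>
     cotorsion_pair \<C> \<Q> (\<W> \<inter> \<R>) \<and> cotorsion_pair \<C> (\<Q> \<inter> \<W>) \<R> \<and> thick \<C> \<W>"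

end

theory Submission imports Defs begin

text \<open>
  The class \<open>\<W>\<close> is forced. If \<open>(\<Q>, \<W>, \<R>)\<close> is a Hovey triple, then \<open>\<W> \<inter> \<R> = \<R>t\<close> and
  \<open>\<Q> \<inter> \<W> = \<Q>t\<close>, since each half of a cotorsion pair is the orthogonal of the other. Hence, in an
  approximation \<open>X \<rightarrow> R \<rightarrow> Q\<close> with \<open>R \<in> \<R>\<close> and \<open>Q \<in> \<Q>t \<subseteq> \<W>\<close>, thickness says that \<open>X \<in> \<W>\<close> if and only if
  \<open>R \<in> \<W> \<inter> \<R> = \<R>t\<close>; this is the first description of \<open>\<W>\<close>, and the second one is dual
  (\<open>hovey_triple_determined\<close>).

  For existence, take the first description as the definition of a class \<open>trivials\<close>. Both
  \<open>trivials \<inter> \<R> = \<R>t\<close> and \<open>\<Q> \<inter> trivials = \<Q>t\<close> are short consequences of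
  \<open>\<Q>t \<inter> \<R> = \<Q> \<inter> \<R>t\<close> (and of \<open>\<Q>t\<close> being closed under cocones), so only thickness is left. Its
  engine is \<open>trivials_iff_Qt\<close>: in a conflation \<open>X \<rightarrow> Y \<rightarrow> Z\<close> with \<open>Z \<in> \<Q>t\<close>, the object \<open>X\<close> is
  trivial if and only if \<open>Y\<close> is. Consequently an object may be replaced by its approximation in
  \<open>\<R>\<close>, where triviality means membership in \<open>\<R>t\<close>. Applied to both terms of a direct sum, this
  gives closure under summands, because \<open>\<R>t\<close> has it. For two-out-of-three, the first two terms of a
  conflation can be moved into \<open>\<R>\<close>, by a pushout and by (ET4), without changing which of the three
  terms are trivial. The third term then lies in \<open>\<R>\<close> too, as \<open>\<R>\<close> is closed under cones, and
  \<open>two_out_of_three_in_R\<close> reads two-out-of-three off from \<open>\<R>t\<close>; the only case in which closure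
  properties of \<open>\<R>t\<close> do not suffice is that of the first term, where the third term is covered by an
  object of \<open>\<Q> \<inter> \<R>t = \<Q>t \<inter> \<R>\<close> and the engine applies again.

  The extriangulated input is used only at the level of objects: conflations can be composed
  (\<open>conflation_comp_inflations\<close>), pulled back, pushed out and added up, a conflation with zero
  extension splits, and the vanishing of extensions passes to the middle term of a conflation, so
  that both halves of a cotorsion pair are closed under extensions.
\<close>

section \<open>Zero morphisms and direct sums\<close>

context additive_category
begin

lemma zero_arr: "\<guillemotleft>\<one>\<^bsub>Hom A B\<^esub> : A \<rightarrow> B\<guillemotright>"
proof -
  interpret comm_group "Hom A B" by (rule hom_group)
  show ?thesis by simp
qed

lemma comp_zero_left: 
  assumes f: "\<guillemotleft>f : A \<rightarrow> B\<guillemotright>"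
  shows "\<one>\<^bsub>Hom B D\<^esub> \<cdot> f = \<one>\<^bsub>Hom A D\<^esub>"
proof -
  interpret BD: comm_group "Hom B D" by (rule hom_group)
  interpret AD: comm_group "Hom A D" by (rule hom_group)
  have "(\<one>\<^bsub>Hom B D\<^esub> \<cdot> f) \<otimes>\<^bsub>Hom A D\<^esub> (\<one>\<^bsub>Hom B D\<^esub> \<cdot> f) = \<one>\<^bsub>Hom B D\<^esub> \<cdot> f"
    using comp_add_left[OF f zero_arr zero_arr, of D] by simp
  then show ?thesis
    using comp_arr[OF f zero_arr] AD.l_cancel_one by blast
qed

lemma comp_zero_right:
  assumes g: "\<guillemotleft>g : B \<rightarrow> D\<guillemotright>"
  shows "g \<cdot> \<one>\<^bsub>Hom A B\<^esub> = \<one>\<^bsub>Hom A D\<^esub>"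
proof -
  interpret AB: comm_group "Hom A B" by (rule hom_group)
  interpret AD: comm_group "Hom A D" by (rule hom_group)
  have "(g \<cdot> \<one>\<^bsub>Hom A B\<^esub>) \<otimes>\<^bsub>Hom A D\<^esub> (g \<cdot> \<one>\<^bsub>Hom A B\<^esub>) = g \<cdot> \<one>\<^bsub>Hom A B\<^esub>"
    using comp_add_right[OF zero_arr zero_arr g, of A] by simp
  then show ?thesis
    using comp_arr[OF zero_arr g] AD.l_cancel_one by blast
qed

lemma is_iso_Id: "is_iso \<C> A A (Idn A)"
  unfolding is_iso_def using Id_arr comp_Id_left by blast

lemma biproduct_swap:
  assumes "biproduct \<C> A B S i j p q" shows "biproduct \<C> B A S j i q p"
proof -
  interpret comm_group "Hom S S" by (rule hom_group)
  have "\<guillemotleft>i \<cdot> p : S \<rightarrow> S\<guillemotright>" "\<guillemotleft>j \<cdot> q : S \<rightarrow> S\<guillemotright>"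
    using assms comp_arr unfolding biproduct_def by blast+
  then show ?thesis
    using assms m_comm unfolding biproduct_def by metis
qed

lemma biproduct_transport:
  assumes S: "biproduct \<C> A B S i j p q" and b: "\<guillemotleft>b : S \<rightarrow> T\<guillemotright>" and b': "\<guillemotleft>b' : T \<rightarrow> S\<guillemotright>"
    and inv: "b' \<cdot> b = Idn S" "b \<cdot> b' = Idn T"
  shows "biproduct \<C> A B T (b \<cdot> i) (b \<cdot> j) (p \<cdot> b') (q \<cdot> b')"
proof -
  have arr: "\<guillemotleft>i : A \<rightarrow> S\<guillemotright>" "\<guillemotleft>j : B \<rightarrow> S\<guillemotright>" "\<guillemotleft>p : S \<rightarrow> A\<guillemotright>" "\<guillemotleft>q : S \<rightarrow> B\<guillemotright>"
    using S unfolding biproduct_def by auto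
  have cancel: "(v \<cdot> b') \<cdot> (b \<cdot> u) = v \<cdot> u" if u: "\<guillemotleft>u : U \<rightarrow> S\<guillemotright>" and v: "\<guillemotleft>v : S \<rightarrow> V\<guillemotright>" for u v U V
  proof -
    have "(v \<cdot> b') \<cdot> (b \<cdot> u) = v \<cdot> ((b' \<cdot> b) \<cdot> u)"
      using comp_assoc[OF comp_arr[OF u b] b' v] comp_assoc[OF u b b'] by simp
    then show ?thesis using inv comp_Id_left[OF u] by simp
  qed
  have conj: "(b \<cdot> u) \<cdot> (v \<cdot> b') = b \<cdot> ((u \<cdot> v) \<cdot> b')" if u: "\<guillemotleft>u : U \<rightarrow> S\<guillemotright>" and v: "\<guillemotleft>v : S \<rightarrow> U\<guillemotright>" for u v U
    using comp_assoc[OF comp_arr[OF b' v] u b] comp_assoc[OF b' v u] by simp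
  have e: "\<guillemotleft>i \<cdot> p : S \<rightarrow> S\<guillemotright>" "\<guillemotleft>j \<cdot> q : S \<rightarrow> S\<guillemotright>" using arr comp_arr by blast+
  have "((b \<cdot> i) \<cdot> (p \<cdot> b')) \<otimes>\<^bsub>Hom T T\<^esub> ((b \<cdot> j) \<cdot> (q \<cdot> b'))
      = b \<cdot> (((i \<cdot> p) \<otimes>\<^bsub>Hom S S\<^esub> (j \<cdot> q)) \<cdot> b')"
    using conj[OF arr(1,3)] conj[OF arr(2,4)] comp_add_left[OF b' e]
      comp_add_right[OF comp_arr[OF b' e(1)] comp_arr[OF b' e(2)] b] by simp
  also have "\<dots> = Idn T"
    using S comp_Id_left[OF b'] inv(2) unfolding biproduct_def by simp
  finally show ?thesis
    using S cancel[OF arr(1) arr(3)] cancel[OF arr(1) arr(4)] cancel[OF arr(2) arr(3)]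
      cancel[OF arr(2) arr(4)] arr b b' comp_arr unfolding biproduct_def by auto
qed

text \<open>
  A direct sum with a zero object is the same thing as an isomorphism. So compatibility of a
  construction with direct sums, for all choices of these, contains its invariance under isomorphism;
  \<open>conflation_iso\<close> is obtained in this way.
\<close>
lemma biproduct_zero_object:
  assumes N: "zero_object \<C> N" and a: "is_iso \<C> A A' a"
  shows "\<exists>i j p q. biproduct \<C> A N A' i j p q"
proof -
  obtain a' where a': "\<guillemotleft>a : A \<rightarrow> A'\<guillemotright>" "\<guillemotleft>a' : A' \<rightarrow> A\<guillemotright>" "a' \<cdot> a = Idn A" "a \<cdot> a' = Idn A'"
    using a unfolding is_iso_def by blast
  have from_N: "f = g" if "\<guillemotleft>f : N \<rightarrow> X\<guillemotright>" "\<guillemotleft>g : N \<rightarrow> X\<guillemotright>" for f g X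
    using N that unfolding zero_object_def by blast
  interpret comm_group "Hom A' A'" by (rule hom_group)
  let ?j = "\<one>\<^bsub>Hom N A'\<^esub>" and ?q = "\<one>\<^bsub>Hom A' N\<^esub>"
  have "(a \<cdot> a') \<otimes>\<^bsub>Hom A' A'\<^esub> (?j \<cdot> ?q) = Idn A'"
    using a'(4) Id_arr comp_zero_left[OF zero_arr] by simp
  moreover have "?q \<cdot> ?j = Idn N"
    by (rule from_N[OF comp_arr[OF zero_arr zero_arr] Id_arr])
  ultimately have "biproduct \<C> A N A' a ?j a' ?q"
    unfolding biproduct_def
    using a' zero_arr comp_zero_left comp_zero_right by simp
  then show ?thesis by blast
qed

end


section \<open>Conflations\<close>

text \<open>
  The closure properties of classes of objects depend only on which objects occur in a conflation.
  Forgetting the morphisms and the extension turns the axioms into rules on triples of objects.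
\<close>

definition conflation :: "('o, 'm, 'e, 'z) extcat_scheme \<Rightarrow> 'o \<Rightarrow> 'o \<Rightarrow> 'o \<Rightarrow> bool" where
  "conflation \<C> A B C \<longleftrightarrow> (\<exists>x y \<delta>. etriangle \<C> A B C x y \<delta>)"

context extriangulated_category
begin

lemma Ext_group: "comm_group (Ext C A)"
  using ET1[unfolded biadditive_functor_def, THEN conjunct1] by simp

lemma Emap_hom: "\<guillemotleft>c : C' \<rightarrow> C\<guillemotright> \<Longrightarrow> \<guillemotleft>a : A \<rightarrow> A'\<guillemotright> \<Longrightarrow> Emap c a \<in> hom (Ext C A) (Ext C' A')"
  using ET1[unfolded biadditive_functor_def, THEN conjunct2, THEN conjunct1] by simp

lemma Emap_closed:
  "\<guillemotleft>c : C' \<rightarrow> C\<guillemotright> \<Longrightarrow> \<guillemotleft>a : A \<rightarrow> A'\<guillemotright> \<Longrightarrow> \<delta> \<in> carrier (Ext C A) \<Longrightarrow> Emap c a \<delta> \<in> carrier (Ext C' A')"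
  using Emap_hom by (rule hom_in_carrier)

lemma Emap_mult:
  "\<guillemotleft>c : C' \<rightarrow> C\<guillemotright> \<Longrightarrow> \<guillemotleft>a : A \<rightarrow> A'\<guillemotright> \<Longrightarrow> \<delta> \<in> carrier (Ext C A) \<Longrightarrow> \<epsilon> \<in> carrier (Ext C A) \<Longrightarrow>
    Emap c a (\<delta> \<otimes>\<^bsub>Ext C A\<^esub> \<epsilon>) = Emap c a \<delta> \<otimes>\<^bsub>Ext C' A'\<^esub> Emap c a \<epsilon>"
  using Emap_hom by (rule hom_mult)

lemma Emap_one:
  assumes "\<guillemotleft>c : C' \<rightarrow> C\<guillemotright>" "\<guillemotleft>a : A \<rightarrow> A'\<guillemotright>" shows "Emap c a \<one>\<^bsub>Ext C A\<^esub> = \<one>\<^bsub>Ext C' A'\<^esub>"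
  using hom_one[OF Emap_hom[OF assms]] Ext_group comm_group.axioms(2) by blast

lemma Emap_Id: "\<delta> \<in> carrier (Ext C A) \<Longrightarrow> Emap (Idn C) (Idn A) \<delta> = \<delta>"
  using ET1[unfolded biadditive_functor_def, THEN conjunct2, THEN conjunct2,
    THEN conjunct1] by simp

lemma Emap_comp:
  "\<delta> \<in> carrier (Ext C A) \<Longrightarrow> \<guillemotleft>c : C' \<rightarrow> C\<guillemotright> \<Longrightarrow> \<guillemotleft>c' : C'' \<rightarrow> C'\<guillemotright> \<Longrightarrow> \<guillemotleft>a : A \<rightarrow> A'\<guillemotright> \<Longrightarrow>
    \<guillemotleft>a' : A' \<rightarrow> A''\<guillemotright> \<Longrightarrow> Emap c' a' (Emap c a \<delta>) = Emap (c \<cdot> c') (a' \<cdot> a) \<delta>"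
  using ET1[unfolded biadditive_functor_def, THEN conjunct2, THEN conjunct2, THEN conjunct2,
    THEN conjunct1] by simp

lemma Emap_zero_left:
  assumes \<delta>: "\<delta> \<in> carrier (Ext C A)" and a: "\<guillemotleft>a : A \<rightarrow> A'\<guillemotright>"
  shows "Emap \<one>\<^bsub>Hom C' C\<^esub> a \<delta> = \<one>\<^bsub>Ext C' A'\<^esub>"
proof -
  interpret H: comm_group "Hom C' C" by (rule hom_group)
  interpret E: comm_group "Ext C' A'" by (rule Ext_group)
  let ?z = "\<one>\<^bsub>Hom C' C\<^esub>"
  have "Emap (?z \<otimes>\<^bsub>Hom C' C\<^esub> ?z) a \<delta> = Emap ?z a \<delta> \<otimes>\<^bsub>Ext C' A'\<^esub> Emap ?z a \<delta>"
    using ET1[unfolded biadditive_functor_def, THEN conjunct2, THEN conjunct2, THEN conjunct2, THEN conjunct2, THEN conjunct1,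
      rule_format, OF \<delta> zero_arr zero_arr a] .
  then show ?thesis using Emap_closed[OF zero_arr a \<delta>] by simp
qed

lemma Emap_zero_right:
  assumes \<delta>: "\<delta> \<in> carrier (Ext C A)" and c: "\<guillemotleft>c : C' \<rightarrow> C\<guillemotright>"
  shows "Emap c \<one>\<^bsub>Hom A A'\<^esub> \<delta> = \<one>\<^bsub>Ext C' A'\<^esub>"
proof -
  interpret H: comm_group "Hom A A'" by (rule hom_group)
  interpret E: comm_group "Ext C' A'" by (rule Ext_group)
  let ?z = "\<one>\<^bsub>Hom A A'\<^esub>"
  have "Emap c (?z \<otimes>\<^bsub>Hom A A'\<^esub> ?z) \<delta> = Emap c ?z \<delta> \<otimes>\<^bsub>Ext C' A'\<^esub> Emap c ?z \<delta>"
    using ET1[unfolded biadditive_functor_def, THEN conjunct2, THEN conjunct2, THEN conjunct2, THEN conjunct2, THEN conjunct2,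
      rule_format, OF \<delta> c zero_arr zero_arr] .
  then show ?thesis using Emap_closed[OF c zero_arr \<delta>] by simp
qed

lemma etriangle_exists:
  "\<delta> \<in> carrier (Ext C A) \<Longrightarrow> \<exists>B x y. etriangle \<C> A B C x y \<delta>"
  by (rule ET2[unfolded additive_realization_def realization_def, THEN conjunct1, THEN conjunct1,
        rule_format])

lemma biproduct_etriangle:
  assumes "biproduct \<C> A C S i j p q" shows "etriangle \<C> A S C i q \<one>\<^bsub>Ext C A\<^esub>"
proof -
  interpret comm_group "Ext C A" by (rule Ext_group)
  have "rlz C A \<one>\<^bsub>Ext C A\<^esub> = seq_class \<C> A S C i q"
    using ET2 assms unfolding additive_realization_def by blast
  then show ?thesis using assms unfolding etriangle_def biproduct_def by simp
qed

lemma biproduct_conflation: "biproduct \<C> A C S i j p q \<Longrightarrow> conflation \<C> A S C"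
  using biproduct_etriangle unfolding conflation_def by blast

text \<open>
  A realizing sequence belongs to its own equivalence class, so equal classes provide the isomorphism.
\<close>
lemma etriangle_unique:
  assumes t: "etriangle \<C> A B C x y \<delta>" and t': "etriangle \<C> A B' C x' y' \<delta>"
  shows "\<exists>b. is_iso \<C> B B' b \<and> b \<cdot> x = x' \<and> y' \<cdot> b = y"
proof -
  have arr': "\<guillemotleft>x' : A \<rightarrow> B'\<guillemotright>" "\<guillemotleft>y' : B' \<rightarrow> C\<guillemotright>" using t' unfolding etriangle_def by auto
  have "(x', y') \<in> seq_class \<C> A B' C x' y'"
    unfolding seq_class_def
    using is_iso_Id[of B'] comp_Id_left[OF arr'(1)] comp_Id_right[OF arr'(2)] arr' by blast
  then have "(x', y') \<in> seq_class \<C> A B C x y"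
    using t t' unfolding etriangle_def by simp
  then obtain B1 b where b: "\<guillemotleft>x' : A \<rightarrow> B1\<guillemotright>" "is_iso \<C> B B1 b" "b \<cdot> x = x'" "y' \<cdot> b = y"
    unfolding seq_class_def by blast
  moreover have "B1 = B'" using hom_disjoint[OF b(1) arr'(1)] by simp
  ultimately show ?thesis by blast
qed

text \<open>
  The zero extension is realized by every direct sum, and the isomorphism from \<open>etriangle_unique\<close>
  carries the direct sum structure over to the middle term.
\<close>
lemma split_etriangle_biproduct:
  assumes t: "etriangle \<C> A B C x y \<one>\<^bsub>Ext C A\<^esub>"
  shows "\<exists>j p. biproduct \<C> A C B x j p y"
proof -
  obtain S i j p q where S: "biproduct \<C> A C S i j p q" using biproduct_exists by blast
  obtain b where b: "is_iso \<C> S B b" "b \<cdot> i = x" "y \<cdot> b = q"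
    using etriangle_unique[OF biproduct_etriangle[OF S] t] by blast
  obtain b' where b': "\<guillemotleft>b : S \<rightarrow> B\<guillemotright>" "\<guillemotleft>b' : B \<rightarrow> S\<guillemotright>" "b' \<cdot> b = Idn S" "b \<cdot> b' = Idn B"
    using b(1) unfolding is_iso_def by blast
  have y: "\<guillemotleft>y : B \<rightarrow> C\<guillemotright>" using t unfolding etriangle_def by blast
  have "q \<cdot> b' = y"
    using comp_assoc[OF b'(2) b'(1) y] b(3) b'(4) comp_Id_right[OF y] by simp
  then show ?thesis using biproduct_transport[OF S b'] b(2) by auto
qed

text \<open>
  Additivity of the realization computes the class of an extension with components
  \<open>(\<delta>, 0, 0, \<delta>')\<close>; such an extension exists, namely the sum of the images of \<open>\<delta>\<close> and \<open>\<delta>'\<close> along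
  the projections of \<open>C \<oplus> C'\<close> and the inclusions of \<open>A \<oplus> A'\<close>.
\<close>
lemma conflation_direct_sum:
  assumes t: "conflation \<C> A B C" and t': "conflation \<C> A' B' C'"
    and SA: "biproduct \<C> A A' SA iA jA pA qA"
    and SB: "biproduct \<C> B B' SB iB jB pB qB"
    and SC: "biproduct \<C> C C' SC iC jC pC qC"
  shows "conflation \<C> SA SB SC"
proof -
  obtain x y \<delta> x' y' \<delta>' where t: "etriangle \<C> A B C x y \<delta>" and t': "etriangle \<C> A' B' C' x' y' \<delta>'"
    using t t' unfolding conflation_def by blast
  interpret E: comm_group "Ext SC SA" by (rule Ext_group)
  interpret E11: comm_group "Ext C A" by (rule Ext_group)
  interpret E12: comm_group "Ext C A'" by (rule Ext_group)
  interpret E21: comm_group "Ext C' A" by (rule Ext_group)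
  interpret E22: comm_group "Ext C' A'" by (rule Ext_group)
  have \<delta>: "\<delta> \<in> carrier (Ext C A)" "\<delta>' \<in> carrier (Ext C' A')"
    using t t' unfolding etriangle_def by auto
  have arr: "\<guillemotleft>iA : A \<rightarrow> SA\<guillemotright>" "\<guillemotleft>jA : A' \<rightarrow> SA\<guillemotright>" "\<guillemotleft>pA : SA \<rightarrow> A\<guillemotright>" "\<guillemotleft>qA : SA \<rightarrow> A'\<guillemotright>"
    "\<guillemotleft>iB : B \<rightarrow> SB\<guillemotright>" "\<guillemotleft>jB : B' \<rightarrow> SB\<guillemotright>" "\<guillemotleft>pB : SB \<rightarrow> B\<guillemotright>" "\<guillemotleft>qB : SB \<rightarrow> B'\<guillemotright>"
    "\<guillemotleft>iC : C \<rightarrow> SC\<guillemotright>" "\<guillemotleft>jC : C' \<rightarrow> SC\<guillemotright>" "\<guillemotleft>pC : SC \<rightarrow> C\<guillemotright>" "\<guillemotleft>qC : SC \<rightarrow> C'\<guillemotright>"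
    "\<guillemotleft>x : A \<rightarrow> B\<guillemotright>" "\<guillemotleft>y : B \<rightarrow> C\<guillemotright>" "\<guillemotleft>x' : A' \<rightarrow> B'\<guillemotright>" "\<guillemotleft>y' : B' \<rightarrow> C'\<guillemotright>"
    using SA SB SC t t' unfolding biproduct_def etriangle_def by auto
  have eqA: "pA \<cdot> iA = Idn A" "qA \<cdot> jA = Idn A'" "qA \<cdot> iA = \<one>\<^bsub>Hom A A'\<^esub>" "pA \<cdot> jA = \<one>\<^bsub>Hom A' A\<^esub>"
    using SA unfolding biproduct_def by auto
  have eqC: "pC \<cdot> iC = Idn C" "qC \<cdot> jC = Idn C'" "qC \<cdot> iC = \<one>\<^bsub>Hom C C'\<^esub>" "pC \<cdot> jC = \<one>\<^bsub>Hom C' C\<^esub>"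
    using SC unfolding biproduct_def by auto
  define \<epsilon>1 where "\<epsilon>1 = Emap pC iA \<delta>"
  define \<epsilon>2 where "\<epsilon>2 = Emap qC jA \<delta>'"
  have \<epsilon>12: "\<epsilon>1 \<in> carrier (Ext SC SA)" "\<epsilon>2 \<in> carrier (Ext SC SA)"
    unfolding \<epsilon>1_def \<epsilon>2_def using Emap_closed arr \<delta> by blast+
  have comp1: "Emap c a \<epsilon>1 = Emap (pC \<cdot> c) (a \<cdot> iA) \<delta>"
    and comp2: "Emap c a \<epsilon>2 = Emap (qC \<cdot> c) (a \<cdot> jA) \<delta>'"
    if "\<guillemotleft>c : U \<rightarrow> SC\<guillemotright>" "\<guillemotleft>a : SA \<rightarrow> V\<guillemotright>" for c a U V
    unfolding \<epsilon>1_def \<epsilon>2_def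
    using Emap_comp[OF \<delta>(1) arr(11) that(1) arr(1) that(2)]
      Emap_comp[OF \<delta>(2) arr(12) that(1) arr(2) that(2)] by auto
  have comps1: "Emap iC pA \<epsilon>1 = \<delta>" "Emap iC qA \<epsilon>1 = \<one>\<^bsub>Ext C A'\<^esub>"
    "Emap jC pA \<epsilon>1 = \<one>\<^bsub>Ext C' A\<^esub>" "Emap jC qA \<epsilon>1 = \<one>\<^bsub>Ext C' A'\<^esub>"
    unfolding comp1[OF arr(9,3)] comp1[OF arr(9,4)] comp1[OF arr(10,3)] comp1[OF arr(10,4)] eqA eqC
    using \<delta> by (auto intro!: Emap_Id Emap_zero_left Emap_zero_right Id_arr zero_arr)
  have comps2: "Emap iC pA \<epsilon>2 = \<one>\<^bsub>Ext C A\<^esub>" "Emap iC qA \<epsilon>2 = \<one>\<^bsub>Ext C A'\<^esub>"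
    "Emap jC pA \<epsilon>2 = \<one>\<^bsub>Ext C' A\<^esub>" "Emap jC qA \<epsilon>2 = \<delta>'"
    unfolding comp2[OF arr(9,3)] comp2[OF arr(9,4)] comp2[OF arr(10,3)] comp2[OF arr(10,4)] eqA eqC
    using \<delta> by (auto intro!: Emap_Id Emap_zero_left Emap_zero_right Id_arr zero_arr)
  let ?\<epsilon> = "\<epsilon>1 \<otimes>\<^bsub>Ext SC SA\<^esub> \<epsilon>2"
  have "Emap iC pA ?\<epsilon> = \<delta>" "Emap iC qA ?\<epsilon> = \<one>\<^bsub>Ext C A'\<^esub>"
    "Emap jC pA ?\<epsilon> = \<one>\<^bsub>Ext C' A\<^esub>" "Emap jC qA ?\<epsilon> = \<delta>'"
    unfolding Emap_mult[OF arr(9,3) \<epsilon>12] Emap_mult[OF arr(9,4) \<epsilon>12]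
      Emap_mult[OF arr(10,3) \<epsilon>12] Emap_mult[OF arr(10,4) \<epsilon>12] comps1 comps2
    using \<delta> by simp_all
  moreover have \<epsilon>: "?\<epsilon> \<in> carrier (Ext SC SA)" using \<epsilon>12 by simp
  ultimately have rlz: "rlz SC SA ?\<epsilon> = seq_class \<C> SA SB SC
             ((iB \<cdot> x \<cdot> pA) \<otimes>\<^bsub>Hom SA SB\<^esub> (jB \<cdot> x' \<cdot> qA))
             ((iC \<cdot> y \<cdot> pB) \<otimes>\<^bsub>Hom SB SC\<^esub> (jC \<cdot> y' \<cdot> qB))"
    using ET2[unfolded additive_realization_def, THEN conjunct2, THEN conjunct2, rule_format,
      OF t t' SA SB SC] by blast
  interpret HAB: comm_group "Hom SA SB" by (rule hom_group)
  interpret HBC: comm_group "Hom SB SC" by (rule hom_group)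
  have "\<guillemotleft>(iB \<cdot> x \<cdot> pA) \<otimes>\<^bsub>Hom SA SB\<^esub> (jB \<cdot> x' \<cdot> qA) : SA \<rightarrow> SB\<guillemotright>"
    by (intro HAB.m_closed comp_arr) (use arr in auto)
  moreover have "\<guillemotleft>(iC \<cdot> y \<cdot> pB) \<otimes>\<^bsub>Hom SB SC\<^esub> (jC \<cdot> y' \<cdot> qB) : SB \<rightarrow> SC\<guillemotright>"
    by (intro HBC.m_closed comp_arr) (use arr in auto)
  ultimately show ?thesis using rlz \<epsilon> unfolding conflation_def etriangle_def by blast
qed

text \<open>
  Add the trivial conflation of a zero object and view the three isomorphisms as direct sums with it.
\<close>
lemma conflation_iso:
  assumes t: "conflation \<C> A B C"
    and iso: "is_iso \<C> A A' a" "is_iso \<C> B B' b" "is_iso \<C> C C' c"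
  shows "conflation \<C> A' B' C'"
proof -
  obtain N where N: "zero_object \<C> N" using zero_object_exists by blast
  have "conflation \<C> N N N"
    using biproduct_zero_object[OF N is_iso_Id] biproduct_conflation by blast
  then show ?thesis
    using conflation_direct_sum[OF t] biproduct_zero_object[OF N iso(1)]
      biproduct_zero_object[OF N iso(2)] biproduct_zero_object[OF N iso(3)] by metis
qed

lemma conflation_comp_inflations:
  assumes t: "conflation \<C> A B D" and t': "conflation \<C> B C F"
  obtains E where "conflation \<C> A C E" "conflation \<C> D E F"
proof -
  obtain f f' \<delta> g g' \<delta>' where "etriangle \<C> A B D f f' \<delta>" "etriangle \<C> B C F g g' \<delta>'"
    using t t' unfolding conflation_def by blast
  from ET4[OF this] show ?thesis using that unfolding conflation_def by blast
qed

text \<open>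
  The object \<open>M\<close> plays the role of the pullback of \<open>B1\<close> and \<open>B2\<close> over \<open>C\<close>. It is the middle term of
  a realization of the extension with components \<open>\<delta>1\<close> and \<open>\<delta>2\<close> in \<open>\<bbbE>(C, A1 \<oplus> A2)\<close>. (ET4) for this
  realization and the split conflation of \<open>A1 \<oplus> A2\<close> exhibits the quotient of \<open>M\<close> by one summand as
  a realization of the component at the other one.
\<close>
lemma conflation_pullback:
  assumes t1: "conflation \<C> A1 B1 C" and t2: "conflation \<C> A2 B2 C"
  obtains M where "conflation \<C> A2 M B1" "conflation \<C> A1 M B2"
proof -
  obtain x1 y1 \<delta>1 x2 y2 \<delta>2
    where t1: "etriangle \<C> A1 B1 C x1 y1 \<delta>1" and t2: "etriangle \<C> A2 B2 C x2 y2 \<delta>2"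
    using t1 t2 unfolding conflation_def by blast
  then have \<delta>: "\<delta>1 \<in> carrier (Ext C A1)" "\<delta>2 \<in> carrier (Ext C A2)"
    unfolding etriangle_def by auto
  obtain S i j p q where S: "biproduct \<C> A1 A2 S i j p q" using biproduct_exists by blast
  then have arr: "\<guillemotleft>i : A1 \<rightarrow> S\<guillemotright>" "\<guillemotleft>j : A2 \<rightarrow> S\<guillemotright>" "\<guillemotleft>p : S \<rightarrow> A1\<guillemotright>" "\<guillemotleft>q : S \<rightarrow> A2\<guillemotright>"
    and eq: "p \<cdot> i = Idn A1" "q \<cdot> j = Idn A2" "q \<cdot> i = \<one>\<^bsub>Hom A1 A2\<^esub>" "p \<cdot> j = \<one>\<^bsub>Hom A2 A1\<^esub>"
    unfolding biproduct_def by auto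
  interpret ES: comm_group "Ext C S" by (rule Ext_group)
  interpret E1: comm_group "Ext C A1" by (rule Ext_group)
  interpret E2: comm_group "Ext C A2" by (rule Ext_group)
  define \<epsilon>1 where "\<epsilon>1 = Emap (Idn C) i \<delta>1"
  define \<epsilon>2 where "\<epsilon>2 = Emap (Idn C) j \<delta>2"
  have \<epsilon>: "\<epsilon>1 \<in> carrier (Ext C S)" "\<epsilon>2 \<in> carrier (Ext C S)"
    unfolding \<epsilon>1_def \<epsilon>2_def using Emap_closed Id_arr arr \<delta> by blast+
  let ?\<epsilon> = "\<epsilon>1 \<otimes>\<^bsub>Ext C S\<^esub> \<epsilon>2"
  have push1: "Emap (Idn C) u \<epsilon>1 = Emap (Idn C) (u \<cdot> i) \<delta>1"
    and push2: "Emap (Idn C) u \<epsilon>2 = Emap (Idn C) (u \<cdot> j) \<delta>2" if "\<guillemotleft>u : S \<rightarrow> V\<guillemotright>" for u V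
    unfolding \<epsilon>1_def \<epsilon>2_def
    using Emap_comp[OF \<delta>(1) Id_arr Id_arr arr(1) that] Emap_comp[OF \<delta>(2) Id_arr Id_arr arr(2) that]
      comp_Id_left[OF Id_arr] by auto
  have comps: "push \<C> C p ?\<epsilon> = \<delta>1" "push \<C> C q ?\<epsilon> = \<delta>2"
    unfolding push_def Emap_mult[OF Id_arr arr(3) \<epsilon>] Emap_mult[OF Id_arr arr(4) \<epsilon>]
      push1[OF arr(3)] push1[OF arr(4)] push2[OF arr(3)] push2[OF arr(4)]
    eq Emap_Id[OF \<delta>(1)] Emap_Id[OF \<delta>(2)]
      Emap_zero_right[OF \<delta>(1) Id_arr] Emap_zero_right[OF \<delta>(2) Id_arr]
    using \<delta> by simp_all
  obtain M m n where M: "etriangle \<C> S M C m n ?\<epsilon>" using etriangle_exists \<epsilon> by blast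
  obtain E1 d1 e1 where E1: "conflation \<C> A2 M E1" "etriangle \<C> A1 E1 C d1 e1 \<delta>1"
    using ET4[OF biproduct_etriangle[OF biproduct_swap[OF S]] M]
    unfolding conflation_def comps by blast
  obtain E2 d2 e2 where E2: "conflation \<C> A1 M E2" "etriangle \<C> A2 E2 C d2 e2 \<delta>2"
    using ET4[OF biproduct_etriangle[OF S] M] unfolding conflation_def comps by blast
  obtain b1 where "is_iso \<C> E1 B1 b1" using etriangle_unique[OF E1(2) t1] by blast
  then have "conflation \<C> A2 M B1" using conflation_iso[OF E1(1) is_iso_Id is_iso_Id] by blast
  moreover obtain b2 where "is_iso \<C> E2 B2 b2" using etriangle_unique[OF E2(2) t2] by blast
  then have "conflation \<C> A1 M B2" using conflation_iso[OF E2(1) is_iso_Id is_iso_Id] by blast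
  ultimately show ?thesis using that by blast
qed

text \<open>
  The dual of \<open>conflation_pullback\<close>: \<open>M\<close> realizes the extension in \<open>\<bbbE>(C1 \<oplus> C2, A)\<close> with restrictions
  \<open>\<delta>1\<close> and \<open>\<delta>2\<close>, and the dual of (ET4) identifies the preimages of the summands in \<open>M\<close>.
\<close>
lemma conflation_pushout:
  assumes t1: "conflation \<C> A B1 C1" and t2: "conflation \<C> A B2 C2"
  obtains M where "conflation \<C> B2 M C1" "conflation \<C> B1 M C2"
proof -
  obtain x1 y1 \<delta>1 x2 y2 \<delta>2
    where t1: "etriangle \<C> A B1 C1 x1 y1 \<delta>1" and t2: "etriangle \<C> A B2 C2 x2 y2 \<delta>2"
    using t1 t2 unfolding conflation_def by blast
  then have \<delta>: "\<delta>1 \<in> carrier (Ext C1 A)" "\<delta>2 \<in> carrier (Ext C2 A)"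
    unfolding etriangle_def by auto
  obtain S i j p q where S: "biproduct \<C> C1 C2 S i j p q" using biproduct_exists by blast
  then have arr: "\<guillemotleft>i : C1 \<rightarrow> S\<guillemotright>" "\<guillemotleft>j : C2 \<rightarrow> S\<guillemotright>" "\<guillemotleft>p : S \<rightarrow> C1\<guillemotright>" "\<guillemotleft>q : S \<rightarrow> C2\<guillemotright>"
    and eq: "p \<cdot> i = Idn C1" "q \<cdot> j = Idn C2" "q \<cdot> i = \<one>\<^bsub>Hom C1 C2\<^esub>" "p \<cdot> j = \<one>\<^bsub>Hom C2 C1\<^esub>"
    unfolding biproduct_def by auto
  interpret ES: comm_group "Ext S A" by (rule Ext_group)
  interpret E1: comm_group "Ext C1 A" by (rule Ext_group)
  interpret E2: comm_group "Ext C2 A" by (rule Ext_group)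
  define \<epsilon>1 where "\<epsilon>1 = Emap p (Idn A) \<delta>1"
  define \<epsilon>2 where "\<epsilon>2 = Emap q (Idn A) \<delta>2"
  have \<epsilon>: "\<epsilon>1 \<in> carrier (Ext S A)" "\<epsilon>2 \<in> carrier (Ext S A)"
    unfolding \<epsilon>1_def \<epsilon>2_def using Emap_closed Id_arr arr \<delta> by blast+
  let ?\<epsilon> = "\<epsilon>1 \<otimes>\<^bsub>Ext S A\<^esub> \<epsilon>2"
  have pull1: "Emap u (Idn A) \<epsilon>1 = Emap (p \<cdot> u) (Idn A) \<delta>1"
    and pull2: "Emap u (Idn A) \<epsilon>2 = Emap (q \<cdot> u) (Idn A) \<delta>2" if "\<guillemotleft>u : V \<rightarrow> S\<guillemotright>" for u V
    unfolding \<epsilon>1_def \<epsilon>2_def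
    using Emap_comp[OF \<delta>(1) arr(3) that Id_arr Id_arr] Emap_comp[OF \<delta>(2) arr(4) that Id_arr Id_arr]
      comp_Id_left[OF Id_arr] by auto
  have comps: "pull \<C> A i ?\<epsilon> = \<delta>1" "pull \<C> A j ?\<epsilon> = \<delta>2"
    unfolding pull_def Emap_mult[OF arr(1) Id_arr \<epsilon>] Emap_mult[OF arr(2) Id_arr \<epsilon>]
      pull1[OF arr(1)] pull1[OF arr(2)] pull2[OF arr(1)] pull2[OF arr(2)]
    eq Emap_Id[OF \<delta>(1)] Emap_Id[OF \<delta>(2)]
      Emap_zero_left[OF \<delta>(1) Id_arr] Emap_zero_left[OF \<delta>(2) Id_arr]
    using \<delta> by simp_all
  obtain M m n where M: "etriangle \<C> A M S m n ?\<epsilon>" using etriangle_exists \<epsilon> by blast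
  obtain E1 d1 e1 where E1: "conflation \<C> E1 M C2" "etriangle \<C> A E1 C1 d1 e1 \<delta>1"
    using ET4op[OF M biproduct_etriangle[OF S]]
    unfolding conflation_def comps by blast
  obtain E2 d2 e2 where E2: "conflation \<C> E2 M C1" "etriangle \<C> A E2 C2 d2 e2 \<delta>2"
    using ET4op[OF M biproduct_etriangle[OF biproduct_swap[OF S]]]
    unfolding conflation_def comps by blast
  obtain b1 where "is_iso \<C> E1 B1 b1" using etriangle_unique[OF E1(2) t1] by blast
  then have "conflation \<C> B1 M C2" using conflation_iso[OF E1(1) _ is_iso_Id is_iso_Id] by blast
  moreover obtain b2 where "is_iso \<C> E2 B2 b2" using etriangle_unique[OF E2(2) t2] by blast
  then have "conflation \<C> B2 M C1" using conflation_iso[OF E2(1) _ is_iso_Id is_iso_Id] by blast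
  ultimately show ?thesis using that by blast
qed

section \<open>Vanishing of extensions\<close>

text \<open>
  This follows from exactness of \<open>\<bbbE>(X, A) \<rightarrow> \<bbbE>(X, B) \<rightarrow> \<bbbE>(X, C)\<close>, which comes from (ET4). Let
  \<open>\<epsilon> \<in> \<bbbE>(X, B)\<close> have zero image in \<open>\<bbbE>(X, C)\<close>. Composing inflations gives a conflation
  \<open>C \<rightarrow> E \<rightarrow> X\<close> that realizes this image, hence has a section \<open>s\<close>, together with an extension \<open>\<delta>''\<close>
  such that \<open>x\<^sub>*\<delta>'' = e\<^sup>*\<epsilon>\<close>. Pulling back along \<open>s\<close> yields \<open>\<epsilon> = x\<^sub>*(s\<^sup>*\<delta>'')\<close>.
\<close>
lemma Ext_vanish_middle_covariant:
  assumes t: "conflation \<C> A B C"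
    and A: "carrier (Ext X A) = {\<one>\<^bsub>Ext X A\<^esub>}" and C: "carrier (Ext X C) = {\<one>\<^bsub>Ext X C\<^esub>}"
  shows "carrier (Ext X B) = {\<one>\<^bsub>Ext X B\<^esub>}"
proof -
  interpret comm_group "Ext X B" by (rule Ext_group)
  obtain x y \<delta> where t: "etriangle \<C> A B C x y \<delta>" using t unfolding conflation_def by blast
  then have arr: "\<guillemotleft>x : A \<rightarrow> B\<guillemotright>" "\<guillemotleft>y : B \<rightarrow> C\<guillemotright>" unfolding etriangle_def by auto
  have "\<epsilon> = \<one>\<^bsub>Ext X B\<^esub>" if \<epsilon>: "\<epsilon> \<in> carrier (Ext X B)" for \<epsilon>
  proof -
    obtain D g g' where D: "etriangle \<C> B D X g g' \<epsilon>" using etriangle_exists[OF \<epsilon>] by blast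
    obtain E d e h h' \<delta>'' where E: "\<guillemotleft>e : E \<rightarrow> X\<guillemotright>" "etriangle \<C> A D E h h' \<delta>''"
      "etriangle \<C> C E X d e (push \<C> X y \<epsilon>)" "push \<C> E x \<delta>'' = pull \<C> B e \<epsilon>"
      using ET4[OF t D] by blast
    have "push \<C> X y \<epsilon> = \<one>\<^bsub>Ext X C\<^esub>"
      using Emap_closed[OF Id_arr arr(2) \<epsilon>] C unfolding push_def by simp
    then obtain s p where "biproduct \<C> C X E d s p e"
      using split_etriangle_biproduct E(3) by metis
    then have s: "\<guillemotleft>s : X \<rightarrow> E\<guillemotright>" "e \<cdot> s = Idn X" unfolding biproduct_def by auto
    have \<delta>'': "\<delta>'' \<in> carrier (Ext E A)" using E(2) unfolding etriangle_def by blast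
    have "\<epsilon> = Emap s (Idn B) (Emap e (Idn B) \<epsilon>)"
      using Emap_comp[OF \<epsilon> E(1) s(1) Id_arr Id_arr] s(2) Emap_Id[OF \<epsilon>] comp_Id_left[OF Id_arr] by simp
    also have "\<dots> = Emap s (Idn B) (Emap (Idn E) x \<delta>'')"
      using E(4) unfolding push_def pull_def by simp
    also have "\<dots> = Emap (Idn X) x (Emap s (Idn A) \<delta>'')"
      using Emap_comp[OF \<delta>'' Id_arr s(1) arr(1) Id_arr] Emap_comp[OF \<delta>'' s(1) Id_arr Id_arr arr(1)]
      by (simp add: comp_Id_left[OF s(1)] comp_Id_right[OF s(1)] comp_Id_left[OF arr(1)]
          comp_Id_right[OF arr(1)])
    also have "Emap s (Idn A) \<delta>'' = \<one>\<^bsub>Ext X A\<^esub>"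
      using Emap_closed[OF s(1) Id_arr \<delta>''] A by simp
    finally show ?thesis using Emap_one[OF Id_arr arr(1)] by simp
  qed
  then show ?thesis by auto
qed

text \<open>
  The dual argument, with a retraction of \<open>d\<close> in place of a section of \<open>e\<close>.
\<close>
lemma Ext_vanish_middle_contravariant:
  assumes t: "conflation \<C> A B C"
    and A: "carrier (Ext A X) = {\<one>\<^bsub>Ext A X\<^esub>}" and C: "carrier (Ext C X) = {\<one>\<^bsub>Ext C X\<^esub>}"
  shows "carrier (Ext B X) = {\<one>\<^bsub>Ext B X\<^esub>}"
proof -
  interpret comm_group "Ext B X" by (rule Ext_group)
  obtain x y \<delta> where t: "etriangle \<C> A B C x y \<delta>" using t unfolding conflation_def by blast
  then have arr: "\<guillemotleft>x : A \<rightarrow> B\<guillemotright>" "\<guillemotleft>y : B \<rightarrow> C\<guillemotright>" unfolding etriangle_def by auto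
  have "\<epsilon> = \<one>\<^bsub>Ext B X\<^esub>" if \<epsilon>: "\<epsilon> \<in> carrier (Ext B X)" for \<epsilon>
  proof -
    obtain D f f' where D: "etriangle \<C> X D B f' f \<epsilon>" using etriangle_exists[OF \<epsilon>] by blast
    obtain E d e h h' \<delta>'' where E: "\<guillemotleft>d : X \<rightarrow> E\<guillemotright>" "etriangle \<C> E D C h' h \<delta>''"
      "etriangle \<C> X E A d e (pull \<C> X x \<epsilon>)" "push \<C> B d \<epsilon> = pull \<C> E y \<delta>''"
      using ET4op[OF D t] by blast
    have "pull \<C> X x \<epsilon> = \<one>\<^bsub>Ext A X\<^esub>"
      using Emap_closed[OF arr(1) Id_arr \<epsilon>] A unfolding pull_def by simp
    then obtain s p where "biproduct \<C> X A E d s p e"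
      using split_etriangle_biproduct E(3) by metis
    then have p: "\<guillemotleft>p : E \<rightarrow> X\<guillemotright>" "p \<cdot> d = Idn X" unfolding biproduct_def by auto
    have \<delta>'': "\<delta>'' \<in> carrier (Ext C E)" using E(2) unfolding etriangle_def by blast
    have "\<epsilon> = Emap (Idn B) p (Emap (Idn B) d \<epsilon>)"
      using Emap_comp[OF \<epsilon> Id_arr Id_arr E(1) p(1)] p(2) Emap_Id[OF \<epsilon>] comp_Id_left[OF Id_arr] by simp
    also have "\<dots> = Emap (Idn B) p (Emap y (Idn E) \<delta>'')"
      using E(4) unfolding push_def pull_def by simp
    also have "\<dots> = Emap y (Idn X) (Emap (Idn C) p \<delta>'')"
      using Emap_comp[OF \<delta>'' arr(2) Id_arr Id_arr p(1)] Emap_comp[OF \<delta>'' Id_arr arr(2) p(1) Id_arr]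
      by (simp add: comp_Id_left[OF p(1)] comp_Id_right[OF p(1)] comp_Id_left[OF arr(2)]
          comp_Id_right[OF arr(2)])
    also have "Emap (Idn C) p \<delta>'' = \<one>\<^bsub>Ext C X\<^esub>"
      using Emap_closed[OF Id_arr p(1) \<delta>''] C by simp
    finally show ?thesis using Emap_one[OF arr(2) Id_arr] by simp
  qed
  then show ?thesis by auto
qed

lemma conflation_splits:
  assumes t: "conflation \<C> A B C" and E: "carrier (Ext C A) = {\<one>\<^bsub>Ext C A\<^esub>}"
  shows "\<exists>i j p q. biproduct \<C> A C B i j p q"
proof -
  obtain x y \<delta> where t: "etriangle \<C> A B C x y \<delta>" using t unfolding conflation_def by blast
  then have "\<delta> = \<one>\<^bsub>Ext C A\<^esub>" using E unfolding etriangle_def by blast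
  then show ?thesis using t split_etriangle_biproduct by blast
qed


section \<open>Cotorsion pairs\<close>

text \<open>
  If \<open>X\<close> is orthogonal to \<open>\<Q>\<close>, then the approximation \<open>X \<rightarrow> R \<rightarrow> Q\<close> splits, and \<open>X\<close> is a summand
  of \<open>R\<close>. Thus one half of a cotorsion pair determines the other.
\<close>
lemma cotorsion_pair_right_iff:
  assumes "cotorsion_pair \<C> \<Q> \<R>"
  shows "X \<in> \<R> \<longleftrightarrow> (\<forall>Q\<in>\<Q>. carrier (Ext Q X) = {\<one>\<^bsub>Ext Q X\<^esub>})"
proof
  assume "X \<in> \<R>"
  then show "\<forall>Q\<in>\<Q>. carrier (Ext Q X) = {\<one>\<^bsub>Ext Q X\<^esub>}"
    using assms unfolding cotorsion_pair_def by blast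
next
  assume perp: "\<forall>Q\<in>\<Q>. carrier (Ext Q X) = {\<one>\<^bsub>Ext Q X\<^esub>}"
  obtain R Q where RQ: "R \<in> \<R>" "Q \<in> \<Q>" "conflation \<C> X R Q"
    using assms unfolding cotorsion_pair_def conflation_def by metis
  then obtain i j p q where "biproduct \<C> X Q R i j p q" using conflation_splits perp by blast
  then show "X \<in> \<R>"
    using assms RQ(1) unfolding cotorsion_pair_def closed_under_summands_def by blast
qed

lemma cotorsion_pair_left_iff:
  assumes "cotorsion_pair \<C> \<Q> \<R>"
  shows "X \<in> \<Q> \<longleftrightarrow> (\<forall>R\<in>\<R>. carrier (Ext X R) = {\<one>\<^bsub>Ext X R\<^esub>})"
proof
  assume "X \<in> \<Q>"
  then show "\<forall>R\<in>\<R>. carrier (Ext X R) = {\<one>\<^bsub>Ext X R\<^esub>}"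
    using assms unfolding cotorsion_pair_def by blast
next
  assume perp: "\<forall>R\<in>\<R>. carrier (Ext X R) = {\<one>\<^bsub>Ext X R\<^esub>}"
  obtain R Q where RQ: "R \<in> \<R>" "Q \<in> \<Q>" "conflation \<C> R Q X"
    using assms unfolding cotorsion_pair_def conflation_def by metis
  then obtain i j p q where "biproduct \<C> R X Q i j p q" using conflation_splits perp by blast
  then show "X \<in> \<Q>"
    using assms RQ(2) unfolding cotorsion_pair_def closed_under_summands_def by blast
qed

lemma cotorsion_pair_right_extension_closed:
  assumes "cotorsion_pair \<C> \<Q> \<R>" "conflation \<C> A B C" "A \<in> \<R>" "C \<in> \<R>"
  shows "B \<in> \<R>"
  using Ext_vanish_middle_covariant[OF assms(2)] assms(3,4)
  unfolding cotorsion_pair_right_iff[OF assms(1)] by blast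

lemma cotorsion_pair_left_extension_closed:
  assumes "cotorsion_pair \<C> \<Q> \<R>" "conflation \<C> A B C" "A \<in> \<Q>" "C \<in> \<Q>"
  shows "B \<in> \<Q>"
  using Ext_vanish_middle_contravariant[OF assms(2)] assms(3,4)
  unfolding cotorsion_pair_left_iff[OF assms(1)] by blast

end


section \<open>The thick class of a compatible couple of hereditary cotorsion pairs\<close>

locale compatible_cotorsion_pairs = extriangulated_category \<C>
  for \<C> :: "('o, 'm, 'e, 'z) extcat_scheme" (structure) +
  fixes \<Q> \<R> \<Q>t \<R>t :: "'o set"
  assumes hered: "hereditary_cotorsion_pair \<C> \<Q> \<R>t"
    and heredt: "hereditary_cotorsion_pair \<C> \<Q>t \<R>"
    and Rt_subset: "\<R>t \<subseteq> \<R>"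
    and Qt_subset: "\<Q>t \<subseteq> \<Q>"
    and cores_eq: "\<Q>t \<inter> \<R> = \<Q> \<inter> \<R>t"
begin

lemma pair: "cotorsion_pair \<C> \<Q> \<R>t"
  using hered unfolding hereditary_cotorsion_pair_def by blast

lemma pairt: "cotorsion_pair \<C> \<Q>t \<R>"
  using heredt unfolding hereditary_cotorsion_pair_def by blast

lemma Qt_cocone_closed: "conflation \<C> A B C \<Longrightarrow> B \<in> \<Q>t \<Longrightarrow> C \<in> \<Q>t \<Longrightarrow> A \<in> \<Q>t"
  using heredt unfolding hereditary_cotorsion_pair_def conflation_def by blast

lemma R_cone_closed: "conflation \<C> A B C \<Longrightarrow> A \<in> \<R> \<Longrightarrow> B \<in> \<R> \<Longrightarrow> C \<in> \<R>"
  using heredt unfolding hereditary_cotorsion_pair_def conflation_def by blast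

lemma Rt_cone_closed: "conflation \<C> A B C \<Longrightarrow> A \<in> \<R>t \<Longrightarrow> B \<in> \<R>t \<Longrightarrow> C \<in> \<R>t"
  using hered unfolding hereditary_cotorsion_pair_def conflation_def by blast

lemma R_Qt_coresolution: obtains R Q where "R \<in> \<R>" "Q \<in> \<Q>t" "conflation \<C> X R Q"
  using pairt unfolding cotorsion_pair_def conflation_def by metis

lemma Rt_Q_resolution: obtains R Q where "R \<in> \<R>t" "Q \<in> \<Q>" "conflation \<C> R Q X"
  using pair unfolding cotorsion_pair_def conflation_def by metis

text \<open>
  The elements of the class to be constructed are called trivial, as they become the trivial objects
  of the model structure that corresponds to a Hovey triple.
\<close>
definition trivials :: "'o set" where
  "trivials = {X. \<exists>R\<in>\<R>t. \<exists>Q\<in>\<Q>t. conflation \<C> X R Q}"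

lemma trivialsI: "conflation \<C> X R Q \<Longrightarrow> R \<in> \<R>t \<Longrightarrow> Q \<in> \<Q>t \<Longrightarrow> X \<in> trivials"
  unfolding trivials_def by blast

text \<open>
  For \<open>X \<in> \<R>\<close> the conflation \<open>X \<rightarrow> R \<rightarrow> Q\<close> that makes \<open>X\<close> trivial splits, so \<open>X\<close> is a summand of \<open>R\<close>.
\<close>
lemma trivials_Int_R: "trivials \<inter> \<R> = \<R>t"
proof
  show "trivials \<inter> \<R> \<subseteq> \<R>t"
  proof
    fix X assume "X \<in> trivials \<inter> \<R>"
    then obtain R Q where X: "X \<in> \<R>" "R \<in> \<R>t" "Q \<in> \<Q>t" "conflation \<C> X R Q"
      unfolding trivials_def by blast
    then have "carrier (Ext Q X) = {\<one>\<^bsub>Ext Q X\<^esub>}" using pairt unfolding cotorsion_pair_def by blast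
    then obtain i j p q where "biproduct \<C> X Q R i j p q" using conflation_splits X(4) by blast
    then show "X \<in> \<R>t"
      using pair X(2) unfolding cotorsion_pair_def closed_under_summands_def by blast
  qed
next
  show "\<R>t \<subseteq> trivials \<inter> \<R>"
  proof
    fix X assume X: "X \<in> \<R>t"
    obtain N where N: "zero_object \<C> N" using zero_object_exists by blast
    have "conflation \<C> X X N"
      using biproduct_zero_object[OF N is_iso_Id] biproduct_conflation by blast
    moreover have "N \<in> \<Q>t"
      using N pairt unfolding cotorsion_pair_def closed_under_direct_sums_def by blast
    ultimately show "X \<in> trivials \<inter> \<R>" using X Rt_subset trivialsI by blast
  qed
qed

text \<open>
  In both inclusions the middle term of \<open>X \<rightarrow> R \<rightarrow> Q\<close> lies in \<open>\<Q>t \<inter> \<R> = \<Q> \<inter> \<R>t\<close>: for trivial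
  \<open>X \<in> \<Q>\<close> because \<open>\<Q>\<close> is closed under extensions, for \<open>X \<in> \<Q>t\<close> because \<open>\<Q>t\<close> is.
\<close>
lemma Q_Int_trivials: "\<Q> \<inter> trivials = \<Q>t"
proof
  show "\<Q> \<inter> trivials \<subseteq> \<Q>t"
  proof
    fix X assume "X \<in> \<Q> \<inter> trivials"
    then obtain R Q where X: "X \<in> \<Q>" "R \<in> \<R>t" "Q \<in> \<Q>t" "conflation \<C> X R Q"
      unfolding trivials_def by blast
    then have "R \<in> \<Q>" using cotorsion_pair_left_extension_closed[OF pair] Qt_subset by blast
    then have "R \<in> \<Q>t" using X(2) cores_eq by blast
    then show "X \<in> \<Q>t" using Qt_cocone_closed X by blast
  qed
next
  show "\<Q>t \<subseteq> \<Q> \<inter> trivials"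
  proof
    fix X assume X: "X \<in> \<Q>t"
    obtain R Q where RQ: "R \<in> \<R>" "Q \<in> \<Q>t" "conflation \<C> X R Q" by (rule R_Qt_coresolution)
    then have "R \<in> \<Q>t" using cotorsion_pair_left_extension_closed[OF pairt] X by blast
    then have "R \<in> \<R>t" using RQ(1) cores_eq by blast
    then show "X \<in> \<Q> \<inter> trivials" using X Qt_subset RQ trivialsI by blast
  qed
qed

lemma trivials_cocone_Qt:
  assumes t: "conflation \<C> X Y Z" and Z: "Z \<in> \<Q>t" and Y: "Y \<in> trivials"
  shows "X \<in> trivials"
proof -
  obtain R Q where RQ: "R \<in> \<R>t" "Q \<in> \<Q>t" "conflation \<C> Y R Q"
    using Y unfolding trivials_def by blast
  obtain E where E: "conflation \<C> X R E" "conflation \<C> Z E Q"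
    using conflation_comp_inflations[OF t RQ(3)] .
  then show ?thesis
    using trivialsI RQ(1,2) Z cotorsion_pair_left_extension_closed[OF pairt] by blast
qed

text \<open>
  Push \<open>X \<rightarrow> Y \<rightarrow> Z\<close> out along \<open>X \<rightarrow> R\<close>, where \<open>R \<in> \<R>t\<close>. The result \<open>R \<rightarrow> P \<rightarrow> Z\<close> splits, so \<open>P\<close> is
  a direct sum of two trivial objects, and \<open>Y\<close> is the cocone of a deflation from \<open>P\<close> onto an object
  of \<open>\<Q>t\<close>, which reduces the claim to \<open>trivials_cocone_Qt\<close>.
\<close>
lemma trivials_extension_Qt:
  assumes t: "conflation \<C> X Y Z" and Z: "Z \<in> \<Q>t" and X: "X \<in> trivials"
  shows "Y \<in> trivials"
proof -
  obtain R Q where RQ: "R \<in> \<R>t" "Q \<in> \<Q>t" "conflation \<C> X R Q"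
    using X unfolding trivials_def by blast
  obtain P where P: "conflation \<C> R P Z" "conflation \<C> Y P Q"
    using conflation_pushout[OF t RQ(3)] .
  have "carrier (Ext Z R) = {\<one>\<^bsub>Ext Z R\<^esub>}"
    using Z RQ(1) Qt_subset pair unfolding cotorsion_pair_def by blast
  then have split: "conflation \<C> Z P R"
    using conflation_splits[OF P(1)] biproduct_swap biproduct_conflation by blast
  \<comment> \<open>\<open>P\<close> is trivial: extending \<open>Z\<close> to \<open>R' \<in> \<R>t\<close> embeds \<open>P = Z \<oplus> R\<close> into an extension of \<open>R\<close> by \<open>R'\<close>.\<close>
  have "Z \<in> trivials" using Z Q_Int_trivials by blast
  then obtain R' Q' where RQ': "R' \<in> \<R>t" "Q' \<in> \<Q>t" "conflation \<C> Z R' Q'"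
    unfolding trivials_def by blast
  obtain M where M: "conflation \<C> R' M R" "conflation \<C> P M Q'"
    using conflation_pushout[OF split RQ'(3)] .
  have "M \<in> \<R>t" using cotorsion_pair_right_extension_closed[OF pair M(1) RQ'(1) RQ(1)] .
  then have "P \<in> trivials" using trivialsI M(2) RQ'(2) by blast
  then show ?thesis using trivials_cocone_Qt P(2) RQ(2) by blast
qed

lemma trivials_iff_Qt: "conflation \<C> X Y Z \<Longrightarrow> Z \<in> \<Q>t \<Longrightarrow> X \<in> trivials \<longleftrightarrow> Y \<in> trivials"
  by (rule iffI) (rule trivials_extension_Qt trivials_cocone_Qt, assumption+)+

text \<open>
  The direct sum of approximations of \<open>A\<close> and \<open>B\<close> in \<open>\<R>\<close> is an approximation of \<open>A \<oplus> B\<close>, so it lies in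
  \<open>\<R>t\<close> if \<open>A \<oplus> B\<close> is trivial; then both summands lie in \<open>\<R>t\<close>.
\<close>
lemma summands_trivials: "closed_under_summands \<C> trivials"
  unfolding closed_under_summands_def
proof (intro allI impI)
  fix A B S i j p q
  assume S: "biproduct \<C> A B S i j p q" and triv: "S \<in> trivials"
  obtain RA QA where A: "RA \<in> \<R>" "QA \<in> \<Q>t" "conflation \<C> A RA QA" by (rule R_Qt_coresolution)
  obtain RB QB where B: "RB \<in> \<R>" "QB \<in> \<Q>t" "conflation \<C> B RB QB" by (rule R_Qt_coresolution)
  obtain SR iR jR pR qR where SR: "biproduct \<C> RA RB SR iR jR pR qR" using biproduct_exists by blast
  obtain SQ iQ jQ pQ qQ where SQ: "biproduct \<C> QA QB SQ iQ jQ pQ qQ" using biproduct_exists by blast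
  have t: "conflation \<C> S SR SQ" by (rule conflation_direct_sum[OF A(3) B(3) S SR SQ])
  have "SR \<in> \<R>" "SQ \<in> \<Q>t"
    using pairt A(1,2) B(1,2) SR SQ unfolding cotorsion_pair_def closed_under_direct_sums_def by blast+
  then have "SR \<in> \<R>t" using trivials_iff_Qt[OF t] triv trivials_Int_R by blast
  then have "RA \<in> \<R>t" "RB \<in> \<R>t"
    using SR pair unfolding cotorsion_pair_def closed_under_summands_def by blast+
  then show "A \<in> trivials \<and> B \<in> trivials" using A B trivialsI by blast
qed

text \<open>
  All three terms lie in \<open>\<R>\<close>, where trivial means being in \<open>\<R>t\<close>. That class is closed under
  extensions and cones, but in general not under cocones. For a trivial first term, cover \<open>C\<close> by
  \<open>R \<rightarrow> Q \<rightarrow> C\<close> with \<open>R \<in> \<R>t\<close> and \<open>Q \<in> \<Q>\<close>: then \<open>Q\<close> lies in \<open>\<Q> \<inter> \<R>t \<subseteq> \<Q>t\<close>, and in the pullback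
  \<open>A \<rightarrow> M \<rightarrow> Q\<close> the object \<open>M\<close> is in \<open>\<R>t\<close> as an extension of \<open>B\<close> by \<open>R\<close>.
\<close>
lemma two_out_of_three_in_R:
  assumes t: "conflation \<C> A B C" and A: "A \<in> \<R>" and B: "B \<in> \<R>"
  shows "(A \<in> trivials \<longrightarrow> B \<in> trivials \<longrightarrow> C \<in> trivials) \<and>
    (A \<in> trivials \<longrightarrow> C \<in> trivials \<longrightarrow> B \<in> trivials) \<and>
    (B \<in> trivials \<longrightarrow> C \<in> trivials \<longrightarrow> A \<in> trivials)"
proof (intro conjI impI)
  have C: "C \<in> \<R>" using R_cone_closed t A B .
  have Rt_iff: "X \<in> trivials \<longleftrightarrow> X \<in> \<R>t" if "X \<in> \<R>" for X using that trivials_Int_R by blast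
  show "C \<in> trivials" if "A \<in> trivials" "B \<in> trivials"
    using that Rt_cone_closed[OF t] Rt_iff A B C by blast
  show "B \<in> trivials" if "A \<in> trivials" "C \<in> trivials"
    using that cotorsion_pair_right_extension_closed[OF pair t] Rt_iff A B C by blast
  assume "B \<in> trivials" "C \<in> trivials"
  then have BC: "B \<in> \<R>t" "C \<in> \<R>t" using Rt_iff B C by auto
  obtain R Q where RQ: "R \<in> \<R>t" "Q \<in> \<Q>" "conflation \<C> R Q C" by (rule Rt_Q_resolution)
  have "Q \<in> \<R>t" using cotorsion_pair_right_extension_closed[OF pair RQ(3,1) BC(2)] .
  then have Q: "Q \<in> \<Q>t" using RQ(2) cores_eq by blast
  obtain M where M: "conflation \<C> R M B" "conflation \<C> A M Q"
    using conflation_pullback[OF t RQ(3)] .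
  have "M \<in> trivials"
    using cotorsion_pair_right_extension_closed[OF pair M(1) RQ(1) BC(1)] trivials_Int_R by blast
  then show "A \<in> trivials" using trivials_cocone_Qt[OF M(2) Q] by blast
qed

text \<open>
  Replace \<open>A\<close> by \<open>RA \<in> \<R>\<close> in a pushout and then the new middle term \<open>P\<close> by \<open>RP \<in> \<R>\<close> with (ET4). Each
  of the three terms changes only by conflations with third term in \<open>\<Q>t\<close>, which preserve and reflect
  triviality, and the final conflation \<open>RA \<rightarrow> RP \<rightarrow> E\<close> has its first two terms in \<open>\<R>\<close>.
\<close>
lemma thick_trivials: "thick \<C> trivials"
  unfolding thick_def
proof (intro conjI[OF summands_trivials] allI impI)
  fix A B C x y \<delta>
  assume "etriangle \<C> A B C x y \<delta>"
  then have t: "conflation \<C> A B C" unfolding conflation_def by blast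
  obtain RA QA where A: "RA \<in> \<R>" "QA \<in> \<Q>t" "conflation \<C> A RA QA" by (rule R_Qt_coresolution)
  obtain P where P: "conflation \<C> RA P C" "conflation \<C> B P QA"
    using conflation_pushout[OF t A(3)] .
  obtain RP QP where RP: "RP \<in> \<R>" "QP \<in> \<Q>t" "conflation \<C> P RP QP" by (rule R_Qt_coresolution)
  obtain E where E: "conflation \<C> RA RP E" "conflation \<C> C E QP"
    using conflation_comp_inflations[OF P(1) RP(3)] .
  have "A \<in> trivials \<longleftrightarrow> RA \<in> trivials" "B \<in> trivials \<longleftrightarrow> RP \<in> trivials" "C \<in> trivials \<longleftrightarrow> E \<in> trivials"
    using trivials_iff_Qt[OF A(3,2)] trivials_iff_Qt[OF P(2) A(2)] trivials_iff_Qt[OF RP(3,2)]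
      trivials_iff_Qt[OF E(2) RP(2)] by auto
  then show "(A \<in> trivials \<longrightarrow> B \<in> trivials \<longrightarrow> C \<in> trivials) \<and>
    (A \<in> trivials \<longrightarrow> C \<in> trivials \<longrightarrow> B \<in> trivials) \<and>
    (B \<in> trivials \<longrightarrow> C \<in> trivials \<longrightarrow> A \<in> trivials)"
    using two_out_of_three_in_R[OF E(1) A(1) RP(1)] by simp
qed

lemma hovey_triple_trivials: "hovey_triple \<C> \<Q> trivials \<R>"
  unfolding hovey_triple_def trivials_Int_R Q_Int_trivials using pair pairt thick_trivials by blast

lemma hovey_triple_determined:
  assumes H: "hovey_triple \<C> \<Q> \<W> \<R>"
  shows "\<W> = trivials" and "\<W> = {X. \<exists>R\<in>\<R>t. \<exists>Q\<in>\<Q>t. conflation \<C> R Q X}"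
proof -
  have pairs: "cotorsion_pair \<C> \<Q> (\<W> \<inter> \<R>)" "cotorsion_pair \<C> (\<Q> \<inter> \<W>) \<R>"
    and thick: "thick \<C> \<W>"
    using H unfolding hovey_triple_def by auto
  have WR: "\<W> \<inter> \<R> = \<R>t"
    using cotorsion_pair_right_iff[OF pairs(1)] cotorsion_pair_right_iff[OF pair] by blast
  have QW: "\<Q> \<inter> \<W> = \<Q>t"
    using cotorsion_pair_left_iff[OF pairs(2)] cotorsion_pair_left_iff[OF pairt] by blast
  have mem: "B \<in> \<W> \<Longrightarrow> C \<in> \<W> \<Longrightarrow> A \<in> \<W>" "A \<in> \<W> \<Longrightarrow> C \<in> \<W> \<Longrightarrow> B \<in> \<W>" "A \<in> \<W> \<Longrightarrow> B \<in> \<W> \<Longrightarrow> C \<in> \<W>"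
    if "conflation \<C> A B C" for A B C
    using thick that unfolding thick_def conflation_def by blast+
  have "X \<in> trivials" if "X \<in> \<W>" for X
  proof -
    obtain R Q where RQ: "R \<in> \<R>" "Q \<in> \<Q>t" "conflation \<C> X R Q" by (rule R_Qt_coresolution)
    then have "R \<in> \<W>" using mem(2) that QW by blast
    then show ?thesis using trivialsI RQ WR by blast
  qed
  moreover have "X \<in> \<W>" if "X \<in> trivials" for X
    using that mem(1) WR QW unfolding trivials_def by blast
  ultimately show "\<W> = trivials" by blast
  have "\<exists>R\<in>\<R>t. \<exists>Q\<in>\<Q>t. conflation \<C> R Q X" if "X \<in> \<W>" for X
  proof -
    obtain R Q where RQ: "R \<in> \<R>t" "Q \<in> \<Q>" "conflation \<C> R Q X" by (rule Rt_Q_resolution)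
    then have "Q \<in> \<W>" using mem(2) that WR by blast
    then show ?thesis using RQ QW by blast
  qed
  moreover have "X \<in> \<W>" if "conflation \<C> R Q X" "R \<in> \<R>t" "Q \<in> \<Q>t" for X R Q
    using that mem(3) WR QW by blast
  ultimately show "\<W> = {X. \<exists>R\<in>\<R>t. \<exists>Q\<in>\<Q>t. conflation \<C> R Q X}" by blast
qed

end


theorem theorem1p2:
  fixes \<C> :: "('o, 'm, 'e, 'z) extcat_scheme"
    and \<Q> \<R> \<Q>t \<R>t :: "'o set"
  assumes "extriangulated_category \<C>"
    and "WIC \<C>"
    and "hereditary_cotorsion_pair \<C> \<Q> \<R>t"
    and "hereditary_cotorsion_pair \<C> \<Q>t \<R>"
    and "\<R>t \<subseteq> \<R>"
    and "\<Q>t \<subseteq> \<Q>"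
    and "\<Q>t \<inter> \<R> = \<Q> \<inter> \<R>t"
  shows "(\<exists>!\<W>. thick \<C> \<W> \<and> hovey_triple \<C> \<Q> \<W> \<R>) \<and>
    (\<forall>\<W>. thick \<C> \<W> \<and> hovey_triple \<C> \<Q> \<W> \<R> \<longrightarrow>
       \<W> = {X. \<exists>R\<in>\<R>t. \<exists>Q\<in>\<Q>t. \<exists>x y \<delta>. etriangle \<C> X R Q x y \<delta>} \<and>
       \<W> = {X. \<exists>R'\<in>\<R>t. \<exists>Q'\<in>\<Q>t. \<exists>x y \<delta>. etriangle \<C> R' Q' X x y \<delta>})"
proof -
  interpret compatible_cotorsion_pairs \<C> \<Q> \<R> \<Q>t \<R>t
    using assms(1,3-) by (intro compatible_cotorsion_pairs.intro compatible_cotorsion_pairs_axioms.intro)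
  have unique: "\<exists>!\<W>. thick \<C> \<W> \<and> hovey_triple \<C> \<Q> \<W> \<R>"
  proof (rule ex1I)
    show "thick \<C> trivials \<and> hovey_triple \<C> \<Q> trivials \<R>"
      using thick_trivials hovey_triple_trivials by (rule conjI)
    show "\<W> = trivials" if "thick \<C> \<W> \<and> hovey_triple \<C> \<Q> \<W> \<R>" for \<W>
      using that[THEN conjunct2] by (rule hovey_triple_determined(1))
  qed
  have descriptions: "\<W> = {X. \<exists>R\<in>\<R>t. \<exists>Q\<in>\<Q>t. \<exists>x y \<delta>. etriangle \<C> X R Q x y \<delta>} \<and>
      \<W> = {X. \<exists>R'\<in>\<R>t. \<exists>Q'\<in>\<Q>t. \<exists>x y \<delta>. etriangle \<C> R' Q' X x y \<delta>}"
    if "thick \<C> \<W> \<and> hovey_triple \<C> \<Q> \<W> \<R>" for \<W>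
    using hovey_triple_determined[OF that[THEN conjunct2]] unfolding trivials_def conflation_def by (rule conjI)
  show ?thesis by (rule conjI[OF unique], intro allI impI, rule descriptions)
qed

end
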